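(* Let $\Sigma$ be a marked surface, $\phi\in MC(\Sigma)$, $\boldsymbol p_\Sigma$ a $\phi$-invariant global coefficient and $\dot\triangle$ a dotted triangulation. The local intertwiner satisfies $|\det\mathsf V_\phi^{\dot\triangle}(\boldsymbol p_\Sigma)|=1$.
   Context: Roots of unity. $N$ is a positive odd integer, $q=-e^{\pi i/N}$ ($q^N=1$), $\mathbb Z_N=\mathbb Z/N$, $\gamma(k)=q^{k^2}$, $i^x=e^{\pi ix/2}$. Dilogarithm. $\mathcal F_N=\{(p^+,p^-)\in(\mathbb C^\ast)^2:(p^+)^N+(p^-)^N=1\}$, $\overline{\mathcal F}_N=\mathcal F_N\cup\{(0,1)\}$. $\Psi_{\mathbf p}(X)=\prod_{j=0}^{N-1}(p^-+q^{2j+1}p^+X)^{j/N}$, defined by a convergent power series on $|yX|<1$ ($y=p^+/p^-$) and continued analytically to $\mathbb C\setminus\bigcup_k\{|yX|>1,\arg(yX)=\pi(2k+1)/N\}$, with branches obtained by continuation from $\mathbf p=(0,1)$, so that $\Psi_{\mathbf p}(q^{2k})=\Psi_{\mathbf p}(1)\prod_{j=1}^k(p^-+q^{2j-1}p^+)$; parameters generic so that all $q^{2k}$ lie in the domain. For $\mathsf X^N=1$, $\Psi_{\mathbf p}(\mathsf X)$ acts on $q^{2k}$-eigenvectors by $\Psi_{\mathbf p}(q^{2k})$. Weyl ordering: $[X_1\cdots X_n]=q^{-\sum_{i<j}\epsilon_{ij}}X_1\cdots X_n$ if $X_iX_j=q^{2\epsilon_{ij}}X_jX_i$. Surfaces and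 moves. A marked surface is a compact oriented surface $\Sigma$ with a finite nonempty set $\mathbb M$ of marked points, each boundary component containing one, with $-2\chi(\Sigma\setminus\mathbb M)+|\mathbb M\cap\partial\Sigma|>0$. $MC(\Sigma)=\pi_0\mathrm{Homeo}^+(\Sigma,\mathbb M)$. Ideal triangulations $\triangle$ have vertex set $\mathbb M$, edges $e(\triangle)$, interior edges $e_{\rm int}(\triangle)$, triangles $t(\triangle)$. $\pi_\triangle(\alpha)$ is the encircling edge if $\alpha$ is the interior edge of a self-folded triangle, else $\alpha$. $\varepsilon_{\alpha\beta}=\sum_T\varepsilon_{\alpha\beta}(T)$ over non-self-folded $T$, with $\varepsilon_{\alpha\beta}(T)=1$ (resp. $-1$) if $\pi_\triangle(\beta)$ is obtained from $\pi_\triangle(\alpha)$ by rotating clockwise (resp. counterclockwise) about their common corner in $T$, else $0$. A dotted triangulation $\dot\triangle$ has in addition a chosen corner (dot) in each triangle. Dot rotation $A_v=[\dot\triangle_1,\dot\triangle_2]$: the dot of $v$ moves to the next corner counterclockwise. Flip $T_{vw}=[\dot\triangle_1,\dot\triangle_2]$: in a square with corners $a,b,c,d$ counterclockwise, in $\dot\triangle_1$ $v=abd$ (dot $a$), $w=bcd$ (dot $b$); in $\dot\triangle_2$ $v=acd$ (dot $a$), $w=abc$ (dot $b$); $\kappa=bd$. Global coefficient. A collection $\boldsymbol p_\Sigma=\{\mathbf p^\triangle\}$, $\mathbf p^\triangle\in\prod_{e_{\rm int}(\triangle)}\mathcal F_N\times\prod_{e(\triangle)\setminus e_{\rm int}(\triangle)}\overline{\mathcal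 F}_N$, over all ideal triangulations, such that for each flip at $\kappa$: $p'^\pm_\kappa=p^\mp_\kappa$ and for $\alpha\ne\kappa$ $p'^+_\alpha/p'^-_\alpha=(p^+_\alpha/p^-_\alpha)(p_\kappa^+)^{\varepsilon_{\alpha\kappa}}$ if $\varepsilon_{\alpha\kappa}\ge0$, $(p^+_\alpha/p^-_\alpha)(p_\kappa^-)^{\varepsilon_{\alpha\kappa}}$ if $\varepsilon_{\alpha\kappa}<0$. It is $\phi$-invariant if $\mathbf p^{\phi^{-1}(\triangle)}_{\phi^{-1}(\alpha)}=\mathbf p^\triangle_\alpha$ for all $\triangle$, $\alpha$. Local intertwiner. $V_N$ has basis $|k\rangle$, $k\in\mathbb Z_N$, $\mathsf U|k\rangle=q^{2k}|k\rangle$, $\mathsf P|k\rangle=|k+1\rangle$; $V_{\dot\triangle}=\bigotimes_{t(\triangle)}V_N$. $\mathsf A_v:V_{\dot\triangle_2}\to V_{\dot\triangle_1}$: $|k\rangle\mapsto N^{-1/2}i^{(1-N)/6}\sum_m\gamma(m)^{-1}q^{-2km}|m\rangle$ on the $v$-th factor; $\mathsf T_{vw}=\Psi_{\mathbf p_\kappa^{\triangle_1}}([\mathsf P_v^{-1}\mathsf U_v\mathsf P_w])\frac1N\sum_{i,j}q^{2ij}\mathsf U_w^i\mathsf P_v^j$; label permutations permute factors. A representation path of $\phi$ is a sequence $\omega=E_1\cdots E_m$ of elementary moves and label permutations from $\dot\triangle$ to $\phi^{-1}(\dot\triangle)$; $V_\omega=V_{E_1}\circ\cdots\circ V_{E_m}:V_{\phi^{-1}(\dot\triangle)}\to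 V_{\dot\triangle}$; $\iota_\phi:V_{\dot\triangle}\to V_{\phi^{-1}(\dot\triangle)}$ identifies basis vectors via $v\mapsto\phi^{-1}(v)$; $\mathsf V_\phi^{\dot\triangle}(\boldsymbol p_\Sigma)=V_\omega\circ\iota_\phi$ for any such path $\omega$. *)

theory Defs
  imports
    "HOL-Complex_Analysis.Winding_Numbers"
    "HOL-Homology.Homology_Groups"
    "Jordan_Normal_Form.Determinant"
begin

section \<open>Marked surfaces\<close>

record 'a msurface =
  points :: "'a set"
  atlas :: "('a set \<times> ('a \<Rightarrow> complex)) set"
  marks :: "'a set"

definition half_plane :: "complex set" where
  "half_plane = {z. 0 \<le> Im z}"

text \<open>A map of plane regions, continuous and injective near \<open>z\<close>, preserves the orientation at \<open>z\<close>
  when its local degree, computed as a winding number, is 1.\<close>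

definition orientation_preserving_at :: "(complex \<Rightarrow> complex) \<Rightarrow> complex \<Rightarrow> bool" where
  "orientation_preserving_at h z \<longleftrightarrow>
     (\<exists>e>0. \<forall>r. 0 < r \<and> r < e \<longrightarrow> winding_number (h \<circ> circlepath z r) (h z) = 1)"

definition surface_chart :: "'a::topological_space set \<Rightarrow> 'a set \<times> ('a \<Rightarrow> complex) \<Rightarrow> bool" where
  "surface_chart S = (\<lambda>(U, u). openin (top_of_set S) U
     \<and> openin (top_of_set half_plane) (u ` U) \<and> (\<exists>u'. homeomorphism U (u ` U) u u'))"

definition oriented_surface :: "'a::t2_space msurface \<Rightarrow> bool" where
  "oriented_surface S \<longleftrightarrow>
     (\<forall>c\<in>atlas S. surface_chart (points S) c) \<and> \<Union> (fst ` atlas S) = points S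
     \<and> (\<forall>(U, u)\<in>atlas S. \<forall>(V, v)\<in>atlas S. \<forall>x\<in>U \<inter> V. 0 < Im (u x) \<longrightarrow>
           orientation_preserving_at (v \<circ> inv_into U u) (u x))"

definition bd :: "'a msurface \<Rightarrow> 'a set" where
  "bd S = {x. \<exists>(U, u)\<in>atlas S. x \<in> U \<and> Im (u x) = 0}"

definition int_independent :: "('g, 'm) monoid_scheme \<Rightarrow> 'g set \<Rightarrow> bool" where
  "int_independent G B \<longleftrightarrow> finite B \<and> B \<subseteq> carrier G
     \<and> (\<forall>c :: 'g \<Rightarrow> int. (\<Otimes>\<^bsub>G\<^esub>b\<in>B. b [^]\<^bsub>G\<^esub> c b) = \<one>\<^bsub>G\<^esub> \<longrightarrow> (\<forall>b\<in>B. c b = 0))"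

definition abelian_rank :: "('g, 'm) monoid_scheme \<Rightarrow> nat" where
  "abelian_rank G = Sup {card B |B. int_independent G B}"

definition betti :: "nat \<Rightarrow> 'a topology \<Rightarrow> nat" where
  "betti k X = abelian_rank (homology_group (int k) X)"

definition euler_char :: "'a topology \<Rightarrow> int" where
  "euler_char X = (\<Sum>k | betti k X \<noteq> 0. (-1) ^ k * int (betti k X))"

definition marked_surface :: "'a::t2_space msurface \<Rightarrow> bool" where
  "marked_surface S \<longleftrightarrow> compact (points S) \<and> oriented_surface S
     \<and> finite (marks S) \<and> marks S \<noteq> {} \<and> marks S \<subseteq> points S
     \<and> (\<forall>C\<in>components (bd S). C \<inter> marks S \<noteq> {})
     \<and> - 2 * euler_char (top_of_set (points S - marks S)) + int (card (marks S \<inter> bd S)) > 0"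


section \<open>Mapping classes\<close>

definition marked_homeo :: "'a::t2_space msurface \<Rightarrow> ('a \<Rightarrow> 'a) \<Rightarrow> bool" where
  "marked_homeo S f \<longleftrightarrow> (\<exists>f'. homeomorphism (points S) (points S) f f') \<and> f ` marks S = marks S"

definition homeo_plus :: "'a::t2_space msurface \<Rightarrow> ('a \<Rightarrow> 'a) set" where
  "homeo_plus S = {f. marked_homeo S f
     \<and> (\<forall>(U, u)\<in>atlas S. \<forall>(V, v)\<in>atlas S. \<forall>x\<in>U. f x \<in> V \<and> 0 < Im (u x) \<longrightarrow>
           orientation_preserving_at (v \<circ> f \<circ> inv_into U u) (u x))}"

text \<open>Along an isotopy in the following sense each marked point is fixed, the set of marked points
  being finite.\<close>

definition isotopic :: "'a::t2_space msurface \<Rightarrow> ('a \<Rightarrow> 'a) \<Rightarrow> ('a \<Rightarrow> 'a) \<Rightarrow> bool" where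
  "isotopic S = homotopic_with_canon (marked_homeo S) (points S) (points S)"

definition MC :: "'a::t2_space msurface \<Rightarrow> ('a \<Rightarrow> 'a) set set" where
  "MC S = homeo_plus S // {(f, g). f \<in> homeo_plus S \<and> g \<in> homeo_plus S \<and> isotopic S f g}"


section \<open>Ideal triangulations\<close>

type_synonym 'a arc = "'a set set"
type_synonym 'a ideal_triangulation = "'a arc set"

text \<open>The isotopy class, relative to the marked points, of a subset of the surface.\<close>

definition arc_class :: "'a::t2_space msurface \<Rightarrow> 'a set \<Rightarrow> 'a arc" where
  "arc_class S e = {h ` e |h. isotopic S id h}"

text \<open>The model triangle; its corners \<open>tri_vertex 0, tri_vertex 1, tri_vertex 2\<close> are in
  counterclockwise order, and \<open>tri_vertex\<close> has period 3.\<close>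

definition tri_vertex :: "nat \<Rightarrow> complex" where
  "tri_vertex k = cis (2 * pi * real k / 3)"

definition tri :: "complex set" where
  "tri = convex hull (tri_vertex ` {..<3})"

definition tri_side :: "nat \<Rightarrow> complex set" where
  "tri_side k = closed_segment (tri_vertex k) (tri_vertex (Suc k))"

definition tri_open_side :: "nat \<Rightarrow> complex set" where
  "tri_open_side k = open_segment (tri_vertex k) (tri_vertex (Suc k))"

text \<open>A dotted triangulation is represented by the list of the characteristic maps of its triangles,
  i.e. of maps from the model triangle that carry \<open>tri_vertex 0\<close> to the dotted corner; positions in
  the list are the labels of the triangles, which number the tensor factors. Two sides of one model
  triangle may be glued, so self-folded triangles are included. Lists that are equivalent in the sense
  of \<open>dotted_eq\<close> below represent the same dotted triangulation.\<close>

type_synonym 'a dotted = "(complex \<Rightarrow> 'a) list"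

definition dotted_triangulation :: "'a::t2_space msurface \<Rightarrow> 'a dotted \<Rightarrow> bool" where
  "dotted_triangulation S D \<longleftrightarrow>
     (\<forall>t\<in>set D. continuous_on tri t \<and> t ` tri \<subseteq> points S
        \<and> (\<forall>k. inj_on t (tri_open_side k))
        \<and> {z\<in>tri. t z \<in> marks S} = tri_vertex ` {..<3}
        \<and> (\<forall>(U, u)\<in>atlas S. \<forall>z\<in>interior tri. t z \<in> U \<longrightarrow> orientation_preserving_at (u \<circ> t) z))
     \<and> (\<Union>t\<in>set D. t ` tri) = points S
     \<and> (\<forall>i<length D. \<forall>j<length D. \<forall>x\<in>interior tri. \<forall>y\<in>tri.
          (D ! i) x = (D ! j) y \<longrightarrow> i = j \<and> x = y)
     \<and> (\<forall>s\<in>set D. \<forall>t\<in>set D. \<forall>k l.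
          s ` tri_open_side k = t ` tri_open_side l \<or> s ` tri_open_side k \<inter> t ` tri_open_side l = {})"

definition dotted_eq :: "'a::t2_space msurface \<Rightarrow> 'a dotted \<Rightarrow> 'a dotted \<Rightarrow> bool" where
  "dotted_eq S D D' \<longleftrightarrow> length D' = length D
     \<and> (\<exists>h. isotopic S id h \<and> (\<forall>i<length D. \<exists>r r'. homeomorphism tri tri r r'
          \<and> (\<forall>k. r (tri_vertex k) = tri_vertex k) \<and> (\<forall>z\<in>tri. (D' ! i) z = h ((D ! i) (r z)))))"

definition side_class :: "'a::t2_space msurface \<Rightarrow> 'a dotted \<Rightarrow> nat \<Rightarrow> nat \<Rightarrow> 'a arc" where
  "side_class S D i k = arc_class S ((D ! i) ` tri_side k)"

text \<open>An ideal triangulation is identified with the set of the isotopy classes of its edges.\<close>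

definition edges :: "'a::t2_space msurface \<Rightarrow> 'a dotted \<Rightarrow> 'a ideal_triangulation" where
  "edges S D = {side_class S D i k |i k. i < length D}"

definition ideal_triangulations :: "'a::t2_space msurface \<Rightarrow> 'a ideal_triangulation set" where
  "ideal_triangulations S = {edges S D |D. dotted_triangulation S D}"

definition interior_edges :: "'a::t2_space msurface \<Rightarrow> 'a ideal_triangulation \<Rightarrow> 'a arc set" where
  "interior_edges S T = {\<alpha>\<in>T. \<not> (\<exists>c\<in>\<alpha>. c \<subseteq> bd S)}"

definition self_folded :: "'a::t2_space msurface \<Rightarrow> 'a dotted \<Rightarrow> nat \<Rightarrow> bool" where
  "self_folded S D i \<longleftrightarrow> (\<exists>k. side_class S D i k = side_class S D i (Suc k))"

definition encircling :: "'a::t2_space msurface \<Rightarrow> 'a dotted \<Rightarrow> 'a arc \<Rightarrow> 'a arc \<Rightarrow> bool" where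
  "encircling S D \<alpha> \<beta> \<longleftrightarrow> (\<exists>i<length D. \<exists>k. side_class S D i k = \<alpha>
     \<and> side_class S D i (Suc k) = \<alpha> \<and> side_class S D i (Suc (Suc k)) = \<beta>)"

definition edge_proj :: "'a::t2_space msurface \<Rightarrow> 'a dotted \<Rightarrow> 'a arc \<Rightarrow> 'a arc" where
  "edge_proj S D \<alpha> = (if \<exists>\<beta>. encircling S D \<alpha> \<beta> then THE \<beta>. encircling S D \<alpha> \<beta> else \<alpha>)"

text \<open>Sides \<open>k\<close> and \<open>k + 1\<close> meet at \<open>tri_vertex (k + 1)\<close>, and there the latter is obtained from the
  former by a clockwise rotation inside the triangle.\<close>

definition clockwise_next :: "'a::t2_space msurface \<Rightarrow> 'a dotted \<Rightarrow> nat \<Rightarrow> 'a arc \<Rightarrow> 'a arc \<Rightarrow> bool" where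
  "clockwise_next S D i a b \<longleftrightarrow> (\<exists>k. a = side_class S D i k \<and> b = side_class S D i (Suc k))"

definition exchange_entry :: "'a::t2_space msurface \<Rightarrow> 'a dotted \<Rightarrow> 'a arc \<Rightarrow> 'a arc \<Rightarrow> int" where
  "exchange_entry S D \<alpha> \<beta> = (\<Sum>i | i < length D \<and> \<not> self_folded S D i.
     if clockwise_next S D i (edge_proj S D \<alpha>) (edge_proj S D \<beta>) then 1
     else if clockwise_next S D i (edge_proj S D \<beta>) (edge_proj S D \<alpha>) then - 1 else 0)"


section \<open>Moves and representation paths\<close>

text \<open>The dot of triangle \<open>v\<close> moves from \<open>tri_vertex 0\<close> to \<open>tri_vertex 1\<close>.\<close>

definition dot_rotation :: "'a::t2_space msurface \<Rightarrow> 'a dotted \<Rightarrow> nat \<Rightarrow> 'a dotted \<Rightarrow> bool" where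
  "dot_rotation S D v D' \<longleftrightarrow> dotted_triangulation S D \<and> dotted_triangulation S D' \<and> v < length D
     \<and> dotted_eq S (D[v := (\<lambda>z. (D ! v) (tri_vertex 1 * z))]) D'"

text \<open>The affine map that carries the corners 0, 1, 2 of the model triangle to \<open>a\<close>, \<open>b\<close>, \<open>c\<close>: the
  barycentric coordinate of \<open>z\<close> at corner \<open>k\<close> is \<open>(1 + 2 * inner (tri_vertex k) z) / 3\<close>.\<close>

definition tri_affine :: "complex \<Rightarrow> complex \<Rightarrow> complex \<Rightarrow> complex \<Rightarrow> complex" where
  "tri_affine a b c z = ((1 + 2 * (inner (tri_vertex 0) z)) / 3) *\<^sub>R a
     + ((1 + 2 * (inner (tri_vertex 1) z)) / 3) *\<^sub>R b + ((1 + 2 * (inner (tri_vertex 2) z)) / 3) *\<^sub>R c"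

text \<open>The flip is performed in a square, parametrized by \<open>sq\<close> on the square with the corners
  \<open>a = 1\<close>, \<open>b = \<i>\<close>, \<open>c = -1\<close>, \<open>d = -\<i>\<close>; \<open>\<kappa>\<close> is the diagonal \<open>bd\<close>, replaced by
  the diagonal \<open>\<kappa>' = ac\<close>.\<close>

definition flip_move ::
  "'a::t2_space msurface \<Rightarrow> 'a dotted \<Rightarrow> nat \<Rightarrow> nat \<Rightarrow> 'a arc \<Rightarrow> 'a arc \<Rightarrow> 'a dotted \<Rightarrow> bool" where
  "flip_move S D v w \<kappa> \<kappa>' D' \<longleftrightarrow> dotted_triangulation S D \<and> dotted_triangulation S D'
     \<and> v < length D \<and> w < length D \<and> v \<noteq> w
     \<and> \<kappa> \<in> interior_edges S (edges S D) \<and> \<kappa>' \<in> interior_edges S (edges S D')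
     \<and> (\<exists>sq. let a = 1; b = \<i>; c = - 1; d = - \<i> in
          continuous_on (convex hull {a, b, c, d}) sq
          \<and> dotted_eq S D (D[v := sq \<circ> tri_affine a b d, w := sq \<circ> tri_affine b c d])
          \<and> dotted_eq S (D[v := sq \<circ> tri_affine a c d, w := sq \<circ> tri_affine b c a]) D'
          \<and> \<kappa> = arc_class S (sq ` closed_segment b d)
          \<and> \<kappa>' = arc_class S (sq ` closed_segment a c))"

text \<open>The triangle with label \<open>i\<close> in \<open>D\<close> has label \<open>\<sigma> i\<close> in \<open>D'\<close>.\<close>

definition label_permutation :: "'a::t2_space msurface \<Rightarrow> 'a dotted \<Rightarrow> (nat \<Rightarrow> nat) \<Rightarrow> 'a dotted \<Rightarrow> bool" where
  "label_permutation S D \<sigma> D' \<longleftrightarrow> dotted_triangulation S D \<and> dotted_triangulation S D'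
     \<and> \<sigma> permutes {..<length D} \<and> length D' = length D
     \<and> dotted_eq S D (map (\<lambda>i. D' ! \<sigma> i) [0..<length D])"

text \<open>A flip records the ideal triangulation at which it is performed and the flipped edge, on which
  its operator depends.\<close>

datatype 'a move = Dot nat | Flip nat nat "'a ideal_triangulation" "'a arc" | Relabel "nat \<Rightarrow> nat"

inductive move_path :: "'a::t2_space msurface \<Rightarrow> 'a dotted \<Rightarrow> 'a move list \<Rightarrow> 'a dotted \<Rightarrow> bool"
  for S where
  Nil: "dotted_eq S D D' \<Longrightarrow> move_path S D [] D'"
| Dot: "dot_rotation S D v D1 \<Longrightarrow> move_path S D1 \<omega> D' \<Longrightarrow> move_path S D (Dot v # \<omega>) D'"
| Flip: "flip_move S D v w \<kappa> \<kappa>' D1 \<Longrightarrow> move_path S D1 \<omega> D' \<Longrightarrow>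
    move_path S D (Flip v w (edges S D) \<kappa> # \<omega>) D'"
| Relabel: "label_permutation S D \<sigma> D1 \<Longrightarrow> move_path S D1 \<omega> D' \<Longrightarrow>
    move_path S D (Relabel \<sigma> # \<omega>) D'"

text \<open>The action of the inverse of a mapping class. The triangle \<open>\<phi>\<^sup>-\<^sup>1(v)\<close> of \<open>\<phi>\<^sup>-\<^sup>1(D)\<close> carries the
  label of \<open>v\<close>.\<close>

definition pullback_arc :: "'a msurface \<Rightarrow> ('a \<Rightarrow> 'a) set \<Rightarrow> 'a arc \<Rightarrow> 'a arc" where
  "pullback_arc S \<phi> \<alpha> = {points S \<inter> g -` c |g c. g \<in> \<phi> \<and> c \<in> \<alpha>}"

definition pullback_triangulation ::
  "'a msurface \<Rightarrow> ('a \<Rightarrow> 'a) set \<Rightarrow> 'a ideal_triangulation \<Rightarrow> 'a ideal_triangulation" where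
  "pullback_triangulation S \<phi> T = pullback_arc S \<phi> ` T"

definition pullback_dotted :: "'a msurface \<Rightarrow> ('a \<Rightarrow> 'a) \<Rightarrow> 'a dotted \<Rightarrow> 'a dotted" where
  "pullback_dotted S g D = map (\<lambda>t. inv_into (points S) g \<circ> t) D"

definition representation_path ::
  "'a::t2_space msurface \<Rightarrow> ('a \<Rightarrow> 'a) set \<Rightarrow> 'a dotted \<Rightarrow> 'a move list \<Rightarrow> bool" where
  "representation_path S \<phi> D \<omega> \<longleftrightarrow> (\<exists>g\<in>\<phi>. move_path S D \<omega> (pullback_dotted S g D))"


section \<open>Fermat curves and global coefficients\<close>

definition fermat :: "nat \<Rightarrow> (complex \<times> complex) set" where
  "fermat N = {(a, b). a \<noteq> 0 \<and> b \<noteq> 0 \<and> a ^ N + b ^ N = 1}"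

definition fermat_bar :: "nat \<Rightarrow> (complex \<times> complex) set" where
  "fermat_bar N = insert (0, 1) (fermat N)"

text \<open>A pair \<open>(p\<^sup>+, p\<^sup>-)\<close> for every ideal triangulation and every edge of it.\<close>

type_synonym 'a coefficient = "'a ideal_triangulation \<Rightarrow> 'a arc \<Rightarrow> complex \<times> complex"

definition global_coefficient :: "nat \<Rightarrow> 'a::t2_space msurface \<Rightarrow> 'a coefficient \<Rightarrow> bool" where
  "global_coefficient N S p \<longleftrightarrow>
     (\<forall>T\<in>ideal_triangulations S. \<forall>\<alpha>\<in>T.
        p T \<alpha> \<in> (if \<alpha> \<in> interior_edges S T then fermat N else fermat_bar N))
     \<and> (\<forall>D v w \<kappa> \<kappa>' D'. flip_move S D v w \<kappa> \<kappa>' D' \<longrightarrow>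
          (let P = p (edges S D); P' = p (edges S D') in
             P' \<kappa>' = (snd (P \<kappa>), fst (P \<kappa>))
             \<and> (\<forall>\<alpha>\<in>edges S D - {\<kappa>}. let \<epsilon> = exchange_entry S D \<alpha> \<kappa> in
                  fst (P' \<alpha>) / snd (P' \<alpha>) = fst (P \<alpha>) / snd (P \<alpha>)
                    * (if 0 \<le> \<epsilon> then fst (P \<kappa>) powi \<epsilon> else snd (P \<kappa>) powi \<epsilon>))))"

definition invariant_coefficient ::
  "'a::t2_space msurface \<Rightarrow> ('a \<Rightarrow> 'a) set \<Rightarrow> 'a coefficient \<Rightarrow> bool" where
  "invariant_coefficient S \<phi> p \<longleftrightarrow> (\<forall>T\<in>ideal_triangulations S. \<forall>\<alpha>\<in>T.
     p (pullback_triangulation S \<phi> T) (pullback_arc S \<phi> \<alpha>) = p T \<alpha>)"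


section \<open>The cyclic quantum dilogarithm\<close>

definition qroot :: "nat \<Rightarrow> complex" where
  "qroot N = - exp (pi * \<i> / N)"

definition dilog_domain :: "nat \<Rightarrow> complex \<times> complex \<Rightarrow> complex set" where
  "dilog_domain N p = {X. \<not> (1 < cmod (fst p / snd p * X)
     \<and> (\<exists>k::int. Arg (fst p / snd p * X) = pi * (2 * k + 1) / N))}"

definition generic :: "nat \<Rightarrow> complex \<times> complex \<Rightarrow> bool" where
  "generic N p \<longleftrightarrow> (\<forall>k. qroot N ^ (2 * k) \<in> dilog_domain N p)"

definition generic_coefficient :: "nat \<Rightarrow> 'a::t2_space msurface \<Rightarrow> 'a coefficient \<Rightarrow> bool" where
  "generic_coefficient N S p \<longleftrightarrow>
     (\<forall>T\<in>ideal_triangulations S. \<forall>\<alpha>\<in>interior_edges S T. generic N (p T \<alpha>))"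

text \<open>The product of the \<open>j/N\<close>-th powers of \<open>p\<^sup>- + q\<^sup>2\<^sup>j\<^sup>+\<^sup>1 p\<^sup>+ X\<close>, \<open>0 \<le> j < N\<close>, with
  \<open>p\<^sup>-\<close> extracted: the exponents sum to \<open>(N - 1)/2\<close>, an integer. With the principal branches this is
  the convergent power series on \<open>\<bar>y X\<bar> < 1\<close>, \<open>y = p\<^sup>+/p\<^sup>-\<close>, and its continuation to the slit
  plane \<open>dilog_domain N p\<close>.\<close>

definition dilog_principal :: "nat \<Rightarrow> complex \<times> complex \<Rightarrow> complex \<Rightarrow> complex" where
  "dilog_principal N p X = snd p ^ ((N - 1) div 2)
     * (\<Prod>j<N. (1 + qroot N ^ (2 * j + 1) * (fst p / snd p) * X) powr (of_nat j / of_nat N))"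

text \<open>The branches at \<open>p\<close> obtained by continuation along paths of the curve that start at \<open>(0, 1)\<close>,
  for the arguments \<open>X = q\<^sup>2\<^sup>k\<close>. The continuation starts from the power series and follows a
  continuous \<open>N\<close>-th root of the product of the \<open>j\<close>-th powers of the factors; at
  \<open>X = q\<^sup>2\<^sup>k\<close> the factors have no zeros on the curve.\<close>

definition dilog_branch :: "nat \<Rightarrow> complex \<times> complex \<Rightarrow> (complex \<Rightarrow> complex) \<Rightarrow> bool" where
  "dilog_branch N p f \<longleftrightarrow> (\<exists>\<gamma> F.
     path \<gamma> \<and> path_image \<gamma> \<subseteq> fermat_bar N \<and> pathstart \<gamma> = (0, 1) \<and> pathfinish \<gamma> = p
     \<and> (\<forall>X. X ^ N = 1 \<longrightarrow> continuous_on {0..1} (\<lambda>t. F t X)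
          \<and> (\<exists>e>0. \<forall>t\<in>{0..1}. t < e \<longrightarrow> F t X = dilog_principal N (\<gamma> t) X)
          \<and> (\<forall>t\<in>{0..1}. F t X ^ N =
               (\<Prod>j<N. (snd (\<gamma> t) + qroot N ^ (2 * j + 1) * fst (\<gamma> t) * X) ^ j))
          \<and> F 1 X = f X))"

text \<open>These branches satisfy \<open>\<Psi>\<^sub>p(q\<^sup>2\<^sup>k) = \<Psi>\<^sub>p(1) \<Prod>\<^sub>j (p\<^sup>- + q\<^sup>2\<^sup>j\<^sup>-\<^sup>1 p\<^sup>+)\<close>, the product over
  \<open>1 \<le> j \<le> k\<close>.\<close>

lemma qroot_even_power: "qroot N ^ (2 * k) = cis (2 * pi * real k / real N)"
proof -
  have "qroot N ^ 2 = cis (2 * pi / N)"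
    by (simp add: qroot_def cis_conv_exp exp_double [symmetric] mult_ac)
  then have "qroot N ^ (2 * k) = cis (2 * pi / N) ^ k"
    by (metis power_mult)
  then show ?thesis
    by (simp add: Complex.DeMoivre mult_ac)
qed

lemma qroot_power: assumes "odd N" shows "qroot N ^ N = 1"
proof -
  have "N > 0" using assms by (rule odd_pos)
  have "exp (pi * \<i> / N) ^ N = exp (of_nat N * (pi * \<i> / N))"
    by (rule exp_of_nat_mult [symmetric])
  also have "\<dots> = exp (pi * \<i>)" using \<open>N > 0\<close> by simp
  also have "\<dots> = -1" by simp
  finally have "exp (pi * \<i> / N) ^ N = -1" .
  then show ?thesis
    by (metis qroot_def power_minus_odd[OF assms] minus_minus)
qed

lemma qroot_prod:
  fixes a b :: complex
  assumes "odd N"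
  shows "(\<Prod>j<N. b + qroot N ^ (2 * j + 1) * a) = a ^ N + b ^ N"
proof (cases "a = 0")
  case True
  then show ?thesis using odd_pos[OF assms] by simp
next
  case False
  define c where "c = (\<lambda>j. qroot N ^ (2 * j + 1))"
  have N: "N > 0" using assms by (rule odd_pos)
  have cN: "c j ^ N = 1" for j
    using qroot_power[OF assms] by (simp add: c_def power_mult [symmetric] mult.commute)
      (metis power_mult power_one power_add power_one_right mult.commute mult_1)
  have q0: "qroot N \<noteq> 0" by (simp add: qroot_def)
  have "inj_on (\<lambda>k. qroot N ^ (2 * k)) {..<N}"
    using Complex.bij_betw_roots_unity[OF N] unfolding bij_betw_def qroot_even_power by (rule conjunct1)
  then have inj: "inj_on (\<lambda>j. - (c j * a)) {..<N}"
    using False q0 by (auto simp: inj_on_def c_def)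
  define P where "P = (\<Prod>j<N. [:c j * a, 1:])"
  define Q where "Q = Polynomial.monom 1 N + [:a ^ N:]"
  have degP: "degree P = N"
    unfolding P_def by (subst degree_prod_eq_sum_degree) auto
  have lP: "lead_coeff P = 1"
    unfolding P_def by (simp add: lead_coeff_prod)
  have "P = Q"
  proof (rule poly_eqI_degree_lead_coeff[where n = N and A = "(\<lambda>j. - (c j * a)) ` {..<N}"])
    show "poly.coeff P N = poly.coeff Q N"
      using lP degP N by (simp add: Q_def coeff_pCons split: nat.splits)
    show "N \<le> card ((\<lambda>j. - (c j * a)) ` {..<N})"
      using card_image[OF inj] by simp
    show "degree P \<le> N" using degP by simp
    show "degree Q \<le> N" unfolding Q_def
      by (rule degree_add_le) (auto simp: degree_monom_le)
    fix z assume "z \<in> (\<lambda>j. - (c j * a)) ` {..<N}"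
    then obtain j where j: "j < N" "z = - (c j * a)" by auto
    have "poly P z = 0"
      unfolding P_def poly_prod using j by (intro prod_zero) auto
    moreover have "poly Q z = 0"
      using assms j cN[of j] by (simp add: Q_def poly_monom power_mult_distrib)
    ultimately show "poly P z = poly Q z" by simp
  qed
  then have "poly P b = poly Q b" by simp
  then show ?thesis
    by (simp add: P_def Q_def poly_prod poly_monom c_def add_ac)
qed

lemma dilog_branch_step:
  assumes N: "odd N" and br: "dilog_branch N p f" and X: "X ^ N = 1"
  shows "f (qroot N ^ 2 * X) = f X * (snd p + qroot N * fst p * X)"
proof -
  let ?q = "qroot N"
  have N0: "N > 0" using N by (rule odd_pos)
  obtain \<gamma> F where g: "path \<gamma>" "path_image \<gamma> \<subseteq> fermat_bar N" "pathstart \<gamma> = (0, 1)" "pathfinish \<gamma> = p"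
    and all: "\<forall>X. X ^ N = 1 \<longrightarrow> continuous_on {0..1} (\<lambda>t. F t X)
          \<and> (\<exists>e>0. \<forall>t\<in>{0..1}. t < e \<longrightarrow> F t X = dilog_principal N (\<gamma> t) X)
          \<and> (\<forall>t\<in>{0..1}. F t X ^ N =
               (\<Prod>j<N. (snd (\<gamma> t) + ?q ^ (2 * j + 1) * fst (\<gamma> t) * X) ^ j))
          \<and> F 1 X = f X"
    using br unfolding dilog_branch_def by (elim exE conjE)
  note F = all [rule_format, THEN conjunct1]
    all [rule_format, THEN conjunct2, THEN conjunct1]
    all [rule_format, THEN conjunct2, THEN conjunct2, THEN conjunct1, rule_format]
    all [rule_format, THEN conjunct2, THEN conjunct2, THEN conjunct2]
  define Y where "Y = ?q ^ 2 * X"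
  have Y: "Y ^ N = 1"
    using X qroot_power[OF N] by (simp add: Y_def power_mult_distrib power_mult [symmetric])
      (metis power_mult power_one mult.commute)
  have start: "F 0 Z = 1" if "Z ^ N = 1" for Z
  proof -
    have "F 0 Z = dilog_principal N (\<gamma> 0) Z" using F(2)[OF that] by auto
    also have "\<gamma> 0 = (0, 1)" using g(3) by (simp add: pathstart_def)
    finally show ?thesis by (simp add: dilog_principal_def)
  qed
  define A where "A = (\<lambda>t j. snd (\<gamma> t) + ?q ^ (2 * j + 1) * fst (\<gamma> t) * X)"
  have qper: "?q ^ (2 * N + 1) = ?q"
    using qroot_power[OF N] by (simp add: power_mult mult.commute[of 2 N])
  have AN: "A t N = A t 0" for t by (simp add: A_def qper[simplified])
  have Aprod: "(\<Prod>j<N. A t j) = 1" if "t \<in> {0..1}" for t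
  proof -
    have "\<gamma> t \<in> fermat_bar N" using g(2) that by (auto simp: path_image_def)
    then have "fst (\<gamma> t) ^ N + snd (\<gamma> t) ^ N = 1"
      using N0 by (auto simp: fermat_bar_def fermat_def)
    then show ?thesis
      using qroot_prod[OF N, of "snd (\<gamma> t)" "fst (\<gamma> t) * X"] X
      by (simp add: A_def power_mult_distrib mult_ac)
  qed
  have Aall: "A t j \<noteq> 0" if "t \<in> {0..1}" "j < N" for t j
    using Aprod[OF that(1)] that(2) by (metis finite_lessThan lessThan_iff prod_zero_iff zero_neq_one)
  have A0: "A t 0 \<noteq> 0" if "t \<in> {0..1}" for t
    using Aall[OF that N0] .
  have step: "F t Y ^ N = F t X ^ N * A t 0 ^ N" if t: "t \<in> {0..1}" for t
  proof -
    have FX: "F t X ^ N = (\<Prod>j<N. A t j ^ j)" unfolding A_def by (rule F(3)[OF X t])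
    have FY: "F t Y ^ N = (\<Prod>j<N. A t (Suc j) ^ j)"
      using F(3)[OF Y t] by (simp add: A_def Y_def mult_ac power_add power2_eq_square)
    have "(\<Prod>j<N. A t (Suc j)) * A t 0 = (\<Prod>j<N. A t j) * A t N"
      using prod.lessThan_Suc[of "A t" N] prod.lessThan_Suc_shift[of "A t" N] by (simp add: mult_ac)
    then have S1: "(\<Prod>j<N. A t (Suc j)) = 1"
      using Aprod[OF t] A0[OF t] by (simp add: AN)
    have "(\<Prod>j<N. A t (Suc j) ^ Suc j) = (\<Prod>j<N. A t (Suc j) ^ j)"
      using S1 by (simp add: prod.distrib)
    moreover have "(\<Prod>j<N. A t (Suc j) ^ Suc j) = (\<Prod>j<N. A t j ^ j) * A t N ^ N"
      using prod.lessThan_Suc[of "\<lambda>j. A t j ^ j" N] prod.lessThan_Suc_shift[of "\<lambda>j. A t j ^ j" N] by simp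
    ultimately show ?thesis by (simp add: FX FY AN)
  qed
  have FX0: "F t X \<noteq> 0" if t: "t \<in> {0..1}" for t
  proof -
    have "F t X ^ N = (\<Prod>j<N. A t j ^ j)" unfolding A_def by (rule F(3)[OF X t])
    moreover have "(\<Prod>j<N. A t j ^ j) \<noteq> 0" using Aall[OF t] by simp
    ultimately have "F t X ^ N \<noteq> 0" by (rule ssubst)
    then show ?thesis using N0 by (metis power_0_left less_irrefl)
  qed
  define R where "R = (\<lambda>t. F t Y / (F t X * A t 0))"
  have cg: "continuous_on {0..1} \<gamma>" using g(1) by (simp add: path_def)
  have "R constant_on {0..1}"
  proof (rule continuous_finite_range_constant)
    show "continuous_on {0..1} R"
      unfolding R_def using FX0 A0
      by (intro continuous_intros F(1) X Y) (auto simp: A_def intro!: continuous_intros cg)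
    have "R t ^ N = 1" if "t \<in> {0..1}" for t
      using step[OF that] FX0[OF that] A0[OF that]
      by (simp add: R_def power_divide power_mult_distrib)
    then have "R ` {0..1} \<subseteq> {z. z ^ N = 1}" by auto
    then show "finite (R ` {0..1})"
      using N0 finite_roots_unity finite_subset by (metis One_nat_def Suc_leI)
  qed simp
  then have "R 1 = R 0" by (auto simp: constant_on_def)
  also have "R 0 = 1"
    using start[OF X] start[OF Y] g(3) by (simp add: R_def A_def pathstart_def)
  finally have "F 1 Y = F 1 X * A 1 0"
    using FX0[of 1] A0[of 1] by (simp add: R_def)
  then show ?thesis
    using F(4)[OF X] F(4)[OF Y] g(4) by (simp add: Y_def A_def pathfinish_def mult_ac)
qed

lemma dilog_branch_recursion:
  assumes "odd N" and "dilog_branch N p f"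
  shows "f (qroot N ^ (2 * k)) = f 1 * (\<Prod>j=1..k. snd p + qroot N ^ (2 * j - 1) * fst p)"
proof (induction k)
  case (Suc k)
  have "(qroot N ^ (2 * k)) ^ N = 1"
    using qroot_power[OF assms(1)] by (metis power_mult power_one mult.commute)
  from dilog_branch_step[OF assms this] Suc show ?case
    by (simp add: power_add power2_eq_square mult_ac)
qed simp

definition dilog_choice :: "nat \<Rightarrow> (complex \<times> complex \<Rightarrow> complex \<Rightarrow> complex) \<Rightarrow> bool" where
  "dilog_choice N \<Psi> \<longleftrightarrow> (\<forall>p\<in>fermat N. generic N p \<longrightarrow> dilog_branch N p (\<Psi> p))"


section \<open>Operators and local intertwiners\<close>

text \<open>The tensor power with \<open>n\<close> factors has the standard basis indexed by \<open>{..<N ^ n}\<close>; digit \<open>v\<close> in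
  base \<open>N\<close> of an index is the basis index in factor \<open>v\<close>.\<close>

definition digit :: "nat \<Rightarrow> nat \<Rightarrow> nat \<Rightarrow> nat" where
  "digit N v r = r div N ^ v mod N"

definition on_factor :: "nat \<Rightarrow> nat \<Rightarrow> nat \<Rightarrow> (nat \<Rightarrow> nat \<Rightarrow> complex) \<Rightarrow> complex Matrix.mat" where
  "on_factor N n v a = Matrix.mat (N ^ n) (N ^ n) (\<lambda>(r, c).
     if \<forall>u<n. u \<noteq> v \<longrightarrow> digit N u r = digit N u c then a (digit N v r) (digit N v c) else 0)"

definition U_op :: "nat \<Rightarrow> nat \<Rightarrow> nat \<Rightarrow> complex Matrix.mat" where
  "U_op N n v = on_factor N n v (\<lambda>m k. if m = k then qroot N ^ (2 * k) else 0)"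

definition P_op :: "nat \<Rightarrow> nat \<Rightarrow> nat \<Rightarrow> complex Matrix.mat" where
  "P_op N n v = on_factor N n v (\<lambda>m k. if m = (k + 1) mod N then 1 else 0)"

definition P_inv_op :: "nat \<Rightarrow> nat \<Rightarrow> nat \<Rightarrow> complex Matrix.mat" where
  "P_inv_op N n v = on_factor N n v (\<lambda>m k. if k = (m + 1) mod N then 1 else 0)"

definition A_op :: "nat \<Rightarrow> nat \<Rightarrow> nat \<Rightarrow> complex Matrix.mat" where
  "A_op N n v = on_factor N n v (\<lambda>m k.
     1 / sqrt N * exp (pi * \<i> / 2 * ((1 - of_nat N) / 6))
       * inverse (qroot N ^ (m ^ 2)) * inverse (qroot N ^ (2 * k * m)))"

definition weyl_exponent :: "nat \<Rightarrow> complex Matrix.mat \<Rightarrow> complex Matrix.mat \<Rightarrow> int" where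
  "weyl_exponent N A B = (SOME e. A * B = qroot N powi (2 * e) \<cdot>\<^sub>m (B * A))"

text \<open>The exponents are determined modulo \<open>N\<close> only, which suffices as \<open>q\<^sup>N = 1\<close>.\<close>

definition weyl_product :: "nat \<Rightarrow> complex Matrix.mat list \<Rightarrow> complex Matrix.mat" where
  "weyl_product N Xs = qroot N powi
       (- (\<Sum>(i, j)\<in>{(i, j). i < j \<and> j < length Xs}. weyl_exponent N (Xs ! i) (Xs ! j)))
     \<cdot>\<^sub>m foldr (*) Xs (1\<^sub>m (dim_row (hd Xs)))"

text \<open>For \<open>X ^ N = 1\<close>: the operator that acts on the eigenvectors of \<open>X\<close> with eigenvalue \<open>q\<^sup>2\<^sup>k\<close> by the
  scalar \<open>f (q\<^sup>2\<^sup>k)\<close>.\<close>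

definition apply_fun :: "nat \<Rightarrow> (complex \<Rightarrow> complex) \<Rightarrow> complex Matrix.mat \<Rightarrow> complex Matrix.mat" where
  "apply_fun N f X = (THE M. M \<in> carrier_mat (dim_row X) (dim_row X)
     \<and> (\<forall>k<N. \<forall>x\<in>carrier_vec (dim_row X). X *\<^sub>v x = qroot N ^ (2 * k) \<cdot>\<^sub>v x \<longrightarrow>
          M *\<^sub>v x = f (qroot N ^ (2 * k)) \<cdot>\<^sub>v x))"

definition T_op :: "nat \<Rightarrow> (complex \<Rightarrow> complex) \<Rightarrow> nat \<Rightarrow> nat \<Rightarrow> nat \<Rightarrow> complex Matrix.mat" where
  "T_op N f n v w = apply_fun N f (weyl_product N [P_inv_op N n v, U_op N n v, P_op N n w])
     * Matrix.mat (N ^ n) (N ^ n) (\<lambda>(r, c). 1 / of_nat N *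
         (\<Sum>i<N. \<Sum>j<N. qroot N ^ (2 * i * j) * (U_op N n w ^\<^sub>m i * P_op N n v ^\<^sub>m j) $$ (r, c)))"

text \<open>The permutation of tensor factors that sends factor \<open>\<sigma> i\<close> to factor \<open>i\<close>: like the other
  operators it goes from the space of the target of the move to that of the source.\<close>

definition relabel_op :: "nat \<Rightarrow> nat \<Rightarrow> (nat \<Rightarrow> nat) \<Rightarrow> complex Matrix.mat" where
  "relabel_op N n \<sigma> = Matrix.mat (N ^ n) (N ^ n) (\<lambda>(r, c).
     if \<forall>i<n. digit N i r = digit N (\<sigma> i) c then 1 else 0)"

fun move_op :: "nat \<Rightarrow> (complex \<times> complex \<Rightarrow> complex \<Rightarrow> complex) \<Rightarrow> 'a coefficient \<Rightarrow> nat \<Rightarrow>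
    'a move \<Rightarrow> complex Matrix.mat" where
  "move_op N \<Psi> p n (Dot v) = A_op N n v"
| "move_op N \<Psi> p n (Flip v w T \<kappa>) = T_op N (\<Psi> (p T \<kappa>)) n v w"
| "move_op N \<Psi> p n (Relabel \<sigma>) = relabel_op N n \<sigma>"

definition path_op :: "nat \<Rightarrow> (complex \<times> complex \<Rightarrow> complex \<Rightarrow> complex) \<Rightarrow> 'a coefficient \<Rightarrow> nat \<Rightarrow>
    'a move list \<Rightarrow> complex Matrix.mat" where
  "path_op N \<Psi> p n \<omega> = foldr (*) (map (move_op N \<Psi> p n) \<omega>) (1\<^sub>m (N ^ n))"

text \<open>The identification of the basis vectors for \<open>D\<close> and \<open>\<phi>\<^sup>-\<^sup>1(D)\<close> along \<open>v \<mapsto> \<phi>\<^sup>-\<^sup>1(v)\<close>; these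
  triangles have the same label.\<close>

definition iota_op :: "nat \<Rightarrow> nat \<Rightarrow> complex Matrix.mat" where
  "iota_op N n = 1\<^sub>m (N ^ n)"

definition local_intertwiner :: "nat \<Rightarrow> (complex \<times> complex \<Rightarrow> complex \<Rightarrow> complex) \<Rightarrow>
    'a::t2_space msurface \<Rightarrow> 'a coefficient \<Rightarrow> ('a \<Rightarrow> 'a) set \<Rightarrow> 'a dotted \<Rightarrow> complex Matrix.mat \<Rightarrow> bool" where
  "local_intertwiner N \<Psi> S p \<phi> D V \<longleftrightarrow> (\<exists>\<omega>. representation_path S \<phi> D \<omega>
     \<and> V = path_op N \<Psi> p (length D) \<omega> * iota_op N (length D))"

end

theory Submission
  imports Defs
begin

text \<open>Every elementary move has a determinant of modulus 1. Relabelings and dot rotations are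
  unitary. A flip is \<open>\<Psi>(X) Q\<^sub>v\<^sub>w\<close>, where \<open>Q\<^sub>v\<^sub>w\<close> is the permutation of the basis that
  subtracts the index of factor \<open>w\<close> from that of factor \<open>v\<close>, and where
  \<open>X = q\<^sup>-\<^sup>1 P\<^sub>v\<^sup>-\<^sup>1 U\<^sub>v P\<^sub>w\<close>. Since \<open>X Q\<^sub>w\<^sub>v = Q\<^sub>w\<^sub>v (q\<^sup>-\<^sup>1 P\<^sub>v\<^sup>-\<^sup>1 U\<^sub>v)\<close> and
  \<open>(q\<^sup>-\<^sup>1 P\<^sub>v\<^sup>-\<^sup>1 U\<^sub>v) A\<^sub>v = A\<^sub>v U\<^sub>v\<^sup>-\<^sup>1\<close>, the unitary \<open>Q\<^sub>w\<^sub>v A\<^sub>v\<close> diagonalizes \<open>X\<close>, all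
  \<open>q\<^sup>2\<^sup>k\<close> being eigenvalues of the same multiplicity. Hence \<open>det \<Psi>(X)\<close> is a power of
  \<open>\<Prod>\<^sub>k \<Psi>(q\<^sup>2\<^sup>k)\<close>, whose \<open>N\<close>-th power is
  \<open>\<Prod>\<^sub>j (\<Prod>\<^sub>k p\<^sup>- + q\<^sup>2\<^sup>j\<^sup>+\<^sup>1 q\<^sup>2\<^sup>k p\<^sup>+)\<^sup>j = \<Prod>\<^sub>j ((p\<^sup>+)\<^sup>N + (p\<^sup>-)\<^sup>N)\<^sup>j = 1\<close>.\<close>

section \<open>Digits\<close>

text \<open>Inverse to taking digits as long as all \<open>d u\<close> are below \<open>N\<close>;
  it translates operations on the labels of a basis vector into operations on its index.\<close>

definition assemble :: "nat \<Rightarrow> nat \<Rightarrow> (nat \<Rightarrow> nat) \<Rightarrow> nat" where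
  "assemble N n d = (\<Sum>u<n. d u * N ^ u)"

lemma digit_less: "N > 0 \<Longrightarrow> digit N u r < N"
  by (simp add: digit_def)

lemma assemble_digits:
  assumes "r < N ^ n"
  shows "assemble N n (\<lambda>u. digit N u r) = r"
proof -
  \<comment> \<open>Reducing modulo \<open>N ^ n\<close> makes the claim valid for every
    \<open>r\<close>; the bound \<open>r < N ^ n\<close> itself would not pass down the
    induction.\<close>
  have "r mod N ^ n = assemble N n (\<lambda>u. digit N u r)"
    proof (induction n)
    case (Suc n)
    have "r mod N ^ Suc n = N ^ n * digit N n r + r mod N ^ n"
      unfolding power_Suc2 digit_def by (rule mod_mult2_eq)
    with Suc show ?case by (simp add: assemble_def)
  qed (simp add: assemble_def)
  with assms show ?thesis by simp
qed

text \<open>Basis vectors can thus be compared one tensor factor at a time.\<close>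

lemma digit_eqI:
  assumes "r < N ^ n" "s < N ^ n" "\<And>u. u < n \<Longrightarrow> digit N u r = digit N u s"
  shows "r = s"
proof -
  have "assemble N n (\<lambda>u. digit N u r) = assemble N n (\<lambda>u. digit N u s)"
    unfolding assemble_def using assms(3) by (intro sum.cong) auto
  with assms show ?thesis by (simp add: assemble_digits)
qed

lemma assemble_less:
  assumes "\<And>u. u < n \<Longrightarrow> d u < N"
  shows "assemble N n d < N ^ n"
  using assms
proof (induction n)
  case (Suc n)
  then have "assemble N n d < N ^ n" "Suc (d n) \<le> N" by (auto simp: Suc_leI)
  then have "assemble N (Suc n) d < Suc (d n) * N ^ n"
    by (simp add: assemble_def)
  also have "\<dots> \<le> N * N ^ n" using \<open>Suc (d n) \<le> N\<close> by (rule mult_le_mono1)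
  finally show ?case by simp
qed (simp add: assemble_def)

lemma digit_eq_mod_div:
  assumes "N > 0"
  shows "digit N u r = r mod N ^ Suc u div N ^ u"
proof -
  have "r mod N ^ Suc u = N ^ u * (r div N ^ u mod N) + r mod N ^ u"
    by (metis mod_mult2_eq power_Suc2)
  then show ?thesis using assms by (simp add: digit_def)
qed

lemma digit_assemble:
  assumes "\<And>u. u < n \<Longrightarrow> d u < N" "u < n"
  shows "digit N u (assemble N n d) = d u"
  using assms
proof (induction n)
  case (Suc n)
  have N: "N > 0" using Suc.prems(1)[of u] Suc.prems(2) by simp
  have split: "assemble N (Suc n) d = assemble N n d + d n * N ^ n"
    by (simp add: assemble_def)
  show ?case
  proof (cases "u = n")
    case True
    have "assemble N n d < N ^ n" using Suc.prems(1) by (intro assemble_less) simp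
    then show ?thesis
      unfolding True split using N Suc.prems(1)[of n] by (simp add: digit_def)
  next
    case False
    then have "N ^ Suc u dvd d n * N ^ n"
      using Suc.prems(2) by (intro dvd_mult le_imp_power_dvd) simp
    then have "assemble N (Suc n) d mod N ^ Suc u = assemble N n d mod N ^ Suc u"
      unfolding split by (metis mod_add_right_eq dvd_eq_mod_eq_0 add.right_neutral)
    then have "digit N u (assemble N (Suc n) d) = digit N u (assemble N n d)"
      by (simp only: digit_eq_mod_div[OF N])
    then show ?thesis using Suc False by simp
  qed
qed simp

section \<open>Isometries and monomial matrices\<close>

lemma index_mat_mult:
  assumes "A \<in> carrier_mat a b" "B \<in> carrier_mat b c" "i < a" "j < c"
  shows "(A * B) $$ (i, j) = (\<Sum>k<b. A $$ (i, k) * B $$ (k, j))"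
  using assms by (auto simp: scalar_prod_def atLeast0LessThan intro!: sum.cong)

text \<open>The conjugate transpose, not the adjugate.\<close>

definition adj :: "complex Matrix.mat \<Rightarrow> complex Matrix.mat" where
  "adj A = map_mat cnj (transpose_mat A)"

lemma adj_carrier [simp]: "A \<in> carrier_mat d d \<Longrightarrow> adj A \<in> carrier_mat d d"
  by (simp add: adj_def)

definition isometry :: "nat \<Rightarrow> complex Matrix.mat \<Rightarrow> bool" where
  "isometry d A \<longleftrightarrow> A \<in> carrier_mat d d \<and> adj A * A = 1\<^sub>m d"

text \<open>A left inverse of a square matrix is also a right inverse, so these isometries are the
  unitary matrices.\<close>

lemma isometry_inverse:
  assumes "isometry d A"
  shows "A * adj A = 1\<^sub>m d"
  using assms mat_mult_left_right_inverse[of "adj A" d A] by (simp add: isometry_def)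

text \<open>Conjugation is a ring homomorphism and therefore commutes with the determinant.\<close>

lemma det_adj:
  assumes "A \<in> carrier_mat d d"
  shows "Determinant.det (adj A) = cnj (Determinant.det A)"
proof -
  interpret cnj: comm_ring_hom cnj by unfold_locales auto
  show ?thesis using assms by (simp add: adj_def Determinant.det_transpose)
qed

lemma isometry_det:
  assumes "isometry d A"
  shows "cmod (Determinant.det A) = 1"
proof -
  have A: "A \<in> carrier_mat d d" using assms by (simp add: isometry_def)
  have "cnj (Determinant.det A) * Determinant.det A = Determinant.det (adj A * A)"
    using Determinant.det_mult[OF adj_carrier[OF A] A] det_adj[OF A] by simp
  also have "\<dots> = 1" using assms by (simp add: isometry_def)
  finally have "cmod (cnj (Determinant.det A) * Determinant.det A) = 1" by simp
  then have "cmod (Determinant.det A) ^ 2 = 1" by (simp add: norm_mult power2_eq_square)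
  then show ?thesis by (simp add: power2_eq_1_iff) (metis norm_ge_zero not_one_le_zero neg_0_le_iff_le)
qed

text \<open>The property carried along a path. Unlike unitarity, which a flip need not have, it is
  shared by all moves, and products preserve it.\<close>

definition unimodular :: "nat \<Rightarrow> complex Matrix.mat \<Rightarrow> bool" where
  "unimodular d A \<longleftrightarrow> A \<in> carrier_mat d d \<and> cmod (Determinant.det A) = 1"

lemma unimodular_one: "unimodular d (1\<^sub>m d)"
  by (simp add: unimodular_def)

lemma unimodular_mult: "unimodular d A \<Longrightarrow> unimodular d B \<Longrightarrow> unimodular d (A * B)"
  by (auto simp: unimodular_def Determinant.det_mult norm_mult)

lemma isometry_unimodular: "isometry d A \<Longrightarrow> unimodular d A"
  by (simp add: unimodular_def isometry_det) (simp add: isometry_def)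

lemma isometryI:
  assumes "A \<in> carrier_mat d d"
    and "\<And>i j. i < d \<Longrightarrow> j < d \<Longrightarrow> (\<Sum>k<d. cnj (A $$ (k, i)) * A $$ (k, j)) = (if i = j then 1 else 0)"
  shows "isometry d A"
  unfolding isometry_def
proof (intro conjI eq_matI)
  fix i j assume "i < dim_row (1\<^sub>m d)" "j < dim_col (1\<^sub>m d)"
  then have ij: "i < d" "j < d" by auto
  have "(adj A * A) $$ (i, j) = (\<Sum>k<d. adj A $$ (i, k) * A $$ (k, j))"
    using assms(1) ij by (intro index_mat_mult) auto
  also have "\<dots> = (\<Sum>k<d. cnj (A $$ (k, i)) * A $$ (k, j))"
    using assms(1) ij by (intro sum.cong) (auto simp: adj_def)
  finally show "(adj A * A) $$ (i, j) = 1\<^sub>m d $$ (i, j)" using assms(2)[OF ij] ij by simp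
qed (use assms(1) in \<open>auto simp: adj_def\<close>)

lemma isometry_mult:
  assumes "isometry d A" "isometry d B"
  shows "isometry d (A * B)"
proof -
  have A: "A \<in> carrier_mat d d" "adj A * A = 1\<^sub>m d" and B: "B \<in> carrier_mat d d" "adj B * B = 1\<^sub>m d"
    using assms by (simp_all add: isometry_def)
  interpret cnj: comm_ring_hom cnj by unfold_locales auto
  have "adj (A * B) = adj B * adj A"
    unfolding adj_def using A(1) B(1)
    by (subst Matrix.transpose_mult) (auto intro!: cnj.mat_hom_mult)
  then have "adj (A * B) * (A * B) = adj B * ((adj A * A) * B)"
    using A(1) B(1) by (simp add: assoc_mult_mat[where ?n\<^sub>1=d and ?n\<^sub>2=d and ?n\<^sub>3=d and ?n\<^sub>4=d])
  then show ?thesis using A B by (simp add: isometry_def)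
qed

text \<open>Basis vector \<open>c\<close> goes to \<open>a c\<close> times basis vector
  \<open>\<tau> c\<close>: the weight is read at the source, which fixes where it is evaluated in a
  product.\<close>

definition monomial_mat :: "nat \<Rightarrow> (nat \<Rightarrow> nat) \<Rightarrow> (nat \<Rightarrow> complex) \<Rightarrow> complex Matrix.mat" where
  "monomial_mat d \<tau> a = Matrix.mat d d (\<lambda>(r, c). if r = \<tau> c then a c else 0)"

lemma monomial_carrier [simp]: "monomial_mat d \<tau> a \<in> carrier_mat d d"
  by (simp add: monomial_mat_def)

lemma monomial_dim [simp]:
  "dim_row (monomial_mat d \<tau> a) = d" "dim_col (monomial_mat d \<tau> a) = d"
  by (simp_all add: monomial_mat_def)

lemma monomial_index [simp]:
  "r < d \<Longrightarrow> c < d \<Longrightarrow> monomial_mat d \<tau> a $$ (r, c) = (if r = \<tau> c then a c else 0)"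
  by (simp add: monomial_mat_def)

lemma mat_diag_eq_monomial: "mat_diag d g = monomial_mat d (\<lambda>c. c) g"
  by (simp add: monomial_mat_def mat_diag_def)

lemma monomial_cong:
  "(\<And>c. c < d \<Longrightarrow> \<tau> c = \<tau>' c) \<Longrightarrow> (\<And>c. c < d \<Longrightarrow> a c = a' c) \<Longrightarrow>
    monomial_mat d \<tau> a = monomial_mat d \<tau>' a'"
  by (auto simp: monomial_mat_def intro!: cong_mat)

lemma monomial_smult: "x \<cdot>\<^sub>m monomial_mat d \<tau> a = monomial_mat d \<tau> (\<lambda>c. x * a c)"
  by (rule eq_matI) auto

lemma monomial_mult:
  assumes "\<And>c. c < d \<Longrightarrow> \<tau>' c < d"
  shows "monomial_mat d \<tau> a * monomial_mat d \<tau>' b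
    = monomial_mat d (\<lambda>c. \<tau> (\<tau>' c)) (\<lambda>c. a (\<tau>' c) * b c)"
proof (rule eq_matI)
  fix r c assume "r < dim_row (monomial_mat d (\<lambda>c. \<tau> (\<tau>' c)) (\<lambda>c. a (\<tau>' c) * b c))"
    "c < dim_col (monomial_mat d (\<lambda>c. \<tau> (\<tau>' c)) (\<lambda>c. a (\<tau>' c) * b c))"
  then have rc: "r < d" "c < d" by simp_all
  have "(monomial_mat d \<tau> a * monomial_mat d \<tau>' b) $$ (r, c)
      = (\<Sum>k<d. monomial_mat d \<tau> a $$ (r, k) * monomial_mat d \<tau>' b $$ (k, c))"
    using rc by (intro index_mat_mult) auto
  \<comment> \<open>Column \<open>c\<close> of the right factor is supported in row
    \<open>\<tau>' c\<close>; the bound on \<open>\<tau>'\<close> keeps this row within the range of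
    summation.\<close>
  also have "\<dots> = (\<Sum>k<d. if k = \<tau>' c then (if r = \<tau> k then a k * b c else 0) else 0)"
    using rc by (intro sum.cong) auto
  also have "\<dots> = (if r = \<tau> (\<tau>' c) then a (\<tau>' c) * b c else 0)"
    using assms[OF rc(2)] by simp
  finally show "(monomial_mat d \<tau> a * monomial_mat d \<tau>' b) $$ (r, c)
      = monomial_mat d (\<lambda>c. \<tau> (\<tau>' c)) (\<lambda>c. a (\<tau>' c) * b c) $$ (r, c)"
    using rc by simp
qed simp_all

text \<open>The columns are phases times distinct basis vectors.\<close>

lemma monomial_isometry:
  assumes "\<And>c. c < d \<Longrightarrow> \<tau> c < d" "inj_on \<tau> {..<d}" "\<And>c. c < d \<Longrightarrow> cmod (a c) = 1"
  shows "isometry d (monomial_mat d \<tau> a)"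
proof (rule isometryI)
  fix i j assume ij: "i < d" "j < d"
  have *: "(\<tau> i = \<tau> j) = (i = j)" using ij assms(2) by (auto simp: inj_on_def)
  have "(\<Sum>k<d. cnj (monomial_mat d \<tau> a $$ (k, i)) * monomial_mat d \<tau> a $$ (k, j))
     = (\<Sum>k<d. if k = \<tau> i then (if i = j then cnj (a i) * a i else 0) else 0)"
    using ij * by (intro sum.cong) auto
  also have "\<dots> = (if i = j then cnj (a i) * a i else 0)" using assms(1)[OF ij(1)] by simp
  also have "cnj (a i) * a i = 1"
    using assms(3)[OF ij(1)] complex_norm_square[of "a i"] by (simp add: mult.commute)
  finally show "(\<Sum>k<d. cnj (monomial_mat d \<tau> a $$ (k, i)) * monomial_mat d \<tau> a $$ (k, j))
     = (if i = j then 1 else 0)" by simp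
qed simp

section \<open>Operators on one tensor factor\<close>

lemma on_factor_carrier [simp]: "on_factor N n v a \<in> carrier_mat (N ^ n) (N ^ n)"
  by (simp add: on_factor_def)

lemma on_factor_dim [simp]:
  "dim_row (on_factor N n v a) = N ^ n" "dim_col (on_factor N n v a) = N ^ n"
  by (simp_all add: on_factor_def)

lemma on_factor_cong:
  assumes "N > 0" "\<And>m k. m < N \<Longrightarrow> k < N \<Longrightarrow> a m k = b m k"
  shows "on_factor N n v a = on_factor N n v b"
  unfolding on_factor_def using assms digit_less by (intro cong_mat) auto

lemma on_factor_one:
  assumes "N > 0" "v < n"
  shows "on_factor N n v (\<lambda>m k. if m = k then 1 else 0) = 1\<^sub>m (N ^ n)"
proof (rule eq_matI)
  fix r c assume "r < dim_row (1\<^sub>m (N ^ n))" "c < dim_col (1\<^sub>m (N ^ n))"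
  then have rc: "r < N ^ n" "c < N ^ n" by auto
  have "r = c" if "\<forall>u<n. u \<noteq> v \<longrightarrow> digit N u r = digit N u c" "digit N v r = digit N v c"
    using digit_eqI[OF rc] that by metis
  then show "on_factor N n v (\<lambda>m k. if m = k then 1 else 0) $$ (r, c) = 1\<^sub>m (N ^ n) $$ (r, c)"
    using rc by (auto simp: on_factor_def)
qed simp_all

text \<open>Parametrizes the indices that can occur between two operators on factor
  \<open>v\<close>; it turns a sum over \<open>N ^ n\<close> indices into one over \<open>N\<close>
  digits.\<close>

lemma bij_betw_fiber:
  assumes N: "N > 0" and v: "v < n"
  shows "bij_betw (digit N v) {s\<in>{..<N ^ n}. \<forall>u<n. u \<noteq> v \<longrightarrow> digit N u s = digit N u c} {..<N}"
proof (rule bij_betw_imageI)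
  show "inj_on (digit N v) {s\<in>{..<N ^ n}. \<forall>u<n. u \<noteq> v \<longrightarrow> digit N u s = digit N u c}"
  proof (rule inj_onI)
    fix s t
    assume s: "s \<in> {s\<in>{..<N ^ n}. \<forall>u<n. u \<noteq> v \<longrightarrow> digit N u s = digit N u c}"
      and t: "t \<in> {s\<in>{..<N ^ n}. \<forall>u<n. u \<noteq> v \<longrightarrow> digit N u s = digit N u c}"
      and eq: "digit N v s = digit N v t"
    show "s = t"
    proof (rule digit_eqI)
      fix u assume "u < n"
      then show "digit N u s = digit N u t" using s t eq by (cases "u = v") auto
    qed (use s t in auto)
  qed
  show "digit N v ` {s\<in>{..<N ^ n}. \<forall>u<n. u \<noteq> v \<longrightarrow> digit N u s = digit N u c} = {..<N}"
  proof (intro equalityI subsetI)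
    fix k assume k: "k \<in> {..<N}"
    \<comment> \<open>The preimage of \<open>k\<close> is \<open>c\<close> with digit
      \<open>v\<close> overwritten by \<open>k\<close>.\<close>
    define d where "d = (\<lambda>u. digit N u c)(v := k)"
    have d: "d u < N" for u using k N by (simp add: d_def digit_less)
    have "digit N u (assemble N n d) = d u" if "u < n" for u
      using digit_assemble[OF d that] .
    then have "digit N v (assemble N n d) = k"
      "\<forall>u<n. u \<noteq> v \<longrightarrow> digit N u (assemble N n d) = digit N u c"
      using v by (auto simp: d_def)
    then show "k \<in> digit N v ` {s\<in>{..<N ^ n}. \<forall>u<n. u \<noteq> v \<longrightarrow> digit N u s = digit N u c}"
      using assemble_less[of n d, OF d] by (intro image_eqI[of _ _ "assemble N n d"]) auto
  qed (use N in \<open>auto simp: digit_less\<close>)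
qed

lemma on_factor_mult:
  assumes "N > 0" "v < n"
  shows "on_factor N n v a * on_factor N n v b = on_factor N n v (\<lambda>m k. \<Sum>j<N. a m j * b j k)"
proof (rule eq_matI)
  let ?ab = "on_factor N n v (\<lambda>m k. \<Sum>j<N. a m j * b j k)"
  fix r c assume "r < dim_row ?ab" "c < dim_col ?ab"
  then have rc: "r < N ^ n" "c < N ^ n" by auto
  define E where "E = (\<lambda>s t. \<forall>u<n. u \<noteq> v \<longrightarrow> digit N u s = digit N u t)"
  have "(on_factor N n v a * on_factor N n v b) $$ (r, c)
      = (\<Sum>s<N ^ n. on_factor N n v a $$ (r, s) * on_factor N n v b $$ (s, c))"
    using rc by (intro index_mat_mult) auto
  \<comment> \<open>Once \<open>s\<close> and \<open>c\<close> agree off \<open>v\<close>, agreement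
    of \<open>r\<close> with \<open>s\<close> means agreement of \<open>r\<close> with
    \<open>c\<close>, a condition independent of \<open>s\<close>.\<close>
  also have "\<dots> = (\<Sum>s<N ^ n. if E s c then
      (if E r c then a (digit N v r) (digit N v s) * b (digit N v s) (digit N v c) else 0) else 0)"
    using rc by (intro sum.cong) (auto simp: on_factor_def E_def)
  also have "\<dots> = (\<Sum>s\<in>{s\<in>{..<N ^ n}. E s c}.
      (if E r c then a (digit N v r) (digit N v s) * b (digit N v s) (digit N v c) else 0))"
    by (rule sum.inter_filter[symmetric]) simp
  also have "\<dots> = (\<Sum>j<N. (if E r c then a (digit N v r) j * b j (digit N v c) else 0))"
    unfolding E_def by (rule sum.reindex_bij_betw[OF bij_betw_fiber[OF assms],
      of "\<lambda>j. if \<forall>u<n. u \<noteq> v \<longrightarrow> digit N u r = digit N u c then a (digit N v r) j * b j (digit N v c) else 0"])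
  also have "\<dots> = (if E r c then \<Sum>j<N. a (digit N v r) j * b j (digit N v c) else 0)" by simp
  also have "\<dots> = ?ab $$ (r, c)" using rc by (simp add: on_factor_def E_def)
  finally show "(on_factor N n v a * on_factor N n v b) $$ (r, c) = ?ab $$ (r, c)" .
qed simp_all

lemma on_factor_adj: "adj (on_factor N n v a) = on_factor N n v (\<lambda>m k. cnj (a k m))"
  by (rule eq_matI) (auto simp: adj_def on_factor_def)

lemma on_factor_isometry:
  assumes "N > 0" "v < n"
    and "\<And>m k. m < N \<Longrightarrow> k < N \<Longrightarrow> (\<Sum>j<N. cnj (a j m) * a j k) = (if m = k then 1 else 0)"
  shows "isometry (N ^ n) (on_factor N n v a)"
proof -
  have "adj (on_factor N n v a) * on_factor N n v a
      = on_factor N n v (\<lambda>m k. \<Sum>j<N. cnj (a j m) * a j k)"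
    by (simp add: on_factor_adj on_factor_mult assms(1,2))
  also have "\<dots> = on_factor N n v (\<lambda>m k. if m = k then 1 else 0)"
    by (intro on_factor_cong assms)
  also have "\<dots> = 1\<^sub>m (N ^ n)" using assms(1,2) by (rule on_factor_one)
  finally show ?thesis by (simp add: isometry_def)
qed

section \<open>Replacing one digit of a basis index\<close>

definition set_digit :: "nat \<Rightarrow> nat \<Rightarrow> nat \<Rightarrow> nat \<Rightarrow> nat \<Rightarrow> nat" where
  "set_digit N n v k c = assemble N n ((\<lambda>u. digit N u c)(v := k))"

lemma set_digit_less: "N > 0 \<Longrightarrow> k < N \<Longrightarrow> set_digit N n v k c < N ^ n"
  unfolding set_digit_def by (rule assemble_less) (simp add: digit_less)

lemma digit_set_digit:
  assumes "k < N" "u < n"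
  shows "digit N u (set_digit N n v k c) = (if u = v then k else digit N u c)"
proof -
  have "((\<lambda>u. digit N u c)(v := k)) u < N" for u
    using assms(1) by (simp add: digit_less)
  then show ?thesis
    unfolding set_digit_def using digit_assemble[of n "(\<lambda>u. digit N u c)(v := k)" N u] assms(2) by simp
qed

lemma set_digit_eq_iff:
  assumes "k < N" "v < n" "r < N ^ n"
  shows "r = set_digit N n v k c \<longleftrightarrow>
    digit N v r = k \<and> (\<forall>u<n. u \<noteq> v \<longrightarrow> digit N u r = digit N u c)"
proof
  assume "digit N v r = k \<and> (\<forall>u<n. u \<noteq> v \<longrightarrow> digit N u r = digit N u c)"
  then show "r = set_digit N n v k c"
    using assms by (intro digit_eqI[OF assms(3) set_digit_less]) (auto simp: digit_set_digit)
qed (use assms in \<open>auto simp: digit_set_digit\<close>)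

lemma set_digit_self:
  assumes "N > 0" "v < n" "c < N ^ n"
  shows "set_digit N n v (digit N v c) c = c"
  using set_digit_eq_iff[of "digit N v c" N v n c c] assms by (simp add: digit_less)

text \<open>Bridge between the two encodings: a map of single digits becomes a map of whole indices,
  to which the product rule for monomial matrices applies.\<close>

lemma on_factor_monomial:
  assumes "N > 0" "v < n" "\<And>k. k < N \<Longrightarrow> g k < N"
  shows "on_factor N n v (\<lambda>m k. if m = g k then a k else 0)
    = monomial_mat (N ^ n) (\<lambda>c. set_digit N n v (g (digit N v c)) c) (\<lambda>c. a (digit N v c))"
  by (rule eq_matI) (auto simp: on_factor_def set_digit_eq_iff assms digit_less)

lemma on_factor_diag:
  assumes "N > 0" "v < n"
  shows "on_factor N n v (\<lambda>m k. if m = k then a k else 0) = mat_diag (N ^ n) (\<lambda>c. a (digit N v c))"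
proof -
  have "on_factor N n v (\<lambda>m k. if m = k then a k else 0)
      = monomial_mat (N ^ n) (\<lambda>c. set_digit N n v (digit N v c) c) (\<lambda>c. a (digit N v c))"
    by (rule on_factor_monomial) (use assms in auto)
  also have "\<dots> = monomial_mat (N ^ n) (\<lambda>c. c) (\<lambda>c. a (digit N v c))"
    using assms by (intro monomial_cong) (simp_all add: set_digit_self)
  finally show ?thesis by (simp add: mat_diag_eq_monomial)
qed

section \<open>Powers of the root of unity\<close>

lemma norm_qroot [simp]: "cmod (qroot N) = 1"
  by (simp add: qroot_def)

lemma qroot_nonzero [simp]: "qroot N \<noteq> 0"
  by (simp add: qroot_def)

lemma cnj_qroot [simp]: "cnj (qroot N) = inverse (qroot N)"
  using complex_norm_square[of "qroot N"] by (simp add: inverse_unique)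

lemma qroot_cong:
  assumes "odd N" "k mod N = l mod N"
  shows "qroot N ^ k = qroot N ^ l"
proof -
  have "qroot N ^ k = qroot N ^ (k mod N)" for k
  proof -
    have "qroot N ^ k = qroot N ^ (N * (k div N) + k mod N)" by simp
    also have "\<dots> = qroot N ^ (k mod N)"
      unfolding power_add power_mult qroot_power[OF assms(1)] by simp
    finally show ?thesis .
  qed
  with assms(2) show ?thesis by metis
qed

text \<open>\<open>qroot N ^ 2\<close> is \<open>cis (2 * pi / N)\<close>, a primitive
  \<open>N\<close>-th root of unity.\<close>

lemma bij_betw_qroot:
  assumes "odd N"
  shows "bij_betw (\<lambda>k. qroot N ^ (2 * k)) {..<N} {z. z ^ N = 1}"
  using Complex.bij_betw_roots_unity[OF odd_pos[OF assms]] unfolding qroot_even_power .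

lemma qroot_even_eq_iff:
  assumes "odd N"
  shows "qroot N ^ (2 * k) = qroot N ^ (2 * l) \<longleftrightarrow> k mod N = l mod N"
proof
  assume eq: "qroot N ^ (2 * k) = qroot N ^ (2 * l)"
  have red: "qroot N ^ (2 * (m mod N)) = qroot N ^ (2 * m)" for m
    by (intro qroot_cong[OF assms]) (simp add: mod_mult_right_eq)
  have "inj_on (\<lambda>k. qroot N ^ (2 * k)) {..<N}"
    using bij_betw_qroot[OF assms] by (rule bij_betw_imp_inj_on)
  moreover have "qroot N ^ (2 * (k mod N)) = qroot N ^ (2 * (l mod N))"
    by (simp only: red eq)
  ultimately show "k mod N = l mod N"
    using odd_pos[OF assms] by (auto simp: inj_on_def)
next
  assume "k mod N = l mod N"
  then show "qroot N ^ (2 * k) = qroot N ^ (2 * l)"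
    by (intro qroot_cong[OF assms]) (metis mod_mult_right_eq)
qed

lemma sum_powers_root_unity:
  fixes z :: complex
  assumes "z ^ N = 1"
  shows "(\<Sum>i<N. z ^ i) = (if z = 1 then of_nat N else 0)"
  using assms by (simp add: geometric_sum)

text \<open>Orthogonality of the characters of the cyclic group of order \<open>N\<close>, a
  geometric sum.\<close>

lemma qroot_sum:
  assumes "odd N"
  shows "(\<Sum>i<N. qroot N ^ (2 * i * m)) = (if N dvd m then of_nat N else 0)"
proof -
  have "(\<Sum>i<N. qroot N ^ (2 * i * m)) = (\<Sum>i<N. (qroot N ^ (2 * m)) ^ i)"
    by (simp add: power_mult[symmetric] mult_ac)
  also have "(qroot N ^ (2 * m)) ^ N = 1"
    by (metis mult.commute power_mult power_one qroot_power[OF assms])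
  then have "(\<Sum>i<N. (qroot N ^ (2 * m)) ^ i) = (if qroot N ^ (2 * m) = 1 then of_nat N else 0)"
    by (rule sum_powers_root_unity)
  also have "qroot N ^ (2 * m) = 1 \<longleftrightarrow> N dvd m"
    using qroot_even_eq_iff[OF assms, of m 0] by (simp add: dvd_eq_mod_eq_0)
  finally show ?thesis .
qed

section \<open>Monomial form of the operators\<close>

abbreviation shift_digit :: "nat \<Rightarrow> nat \<Rightarrow> nat \<Rightarrow> nat \<Rightarrow> nat \<Rightarrow> nat" where
  "shift_digit N n v j c \<equiv> set_digit N n v ((digit N v c + j) mod N) c"

lemma U_op_monomial:
  assumes "N > 0" "v < n"
  shows "U_op N n v = monomial_mat (N ^ n) (\<lambda>c. c) (\<lambda>c. qroot N ^ (2 * digit N v c))"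
  by (simp only: U_op_def on_factor_diag[OF assms] mat_diag_eq_monomial)

lemma P_op_monomial:
  assumes "N > 0" "v < n"
  shows "P_op N n v = monomial_mat (N ^ n) (shift_digit N n v 1) (\<lambda>c. 1)"
  unfolding P_op_def by (rule on_factor_monomial) (use assms in auto)

text \<open>Addition of \<open>N - 1\<close> plays the role of subtracting 1 in the cyclic group.
  \<open>P_inv_op\<close> tests the column against the row, whereas the monomial form needs the row
  as a function of the column.\<close>

lemma Suc_mod_eq_iff:
  fixes k m N :: nat
  assumes "m < N" "k < N"
  shows "k = (m + 1) mod N \<longleftrightarrow> m = (k + (N - 1)) mod N"
proof
  assume "k = (m + 1) mod N"
  then have "(k + (N - 1)) mod N = (m + 1 + (N - 1)) mod N" by (simp only: mod_add_left_eq)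
  also have "\<dots> = m" using assms by simp
  finally show "m = (k + (N - 1)) mod N" ..
next
  assume "m = (k + (N - 1)) mod N"
  then have "(m + 1) mod N = (k + (N - 1) + 1) mod N" by (simp only: mod_add_left_eq)
  also have "\<dots> = k" using assms by simp
  finally show "k = (m + 1) mod N" ..
qed

lemma P_inv_op_monomial:
  assumes "N > 0" "v < n"
  shows "P_inv_op N n v = monomial_mat (N ^ n) (shift_digit N n v (N - 1)) (\<lambda>c. 1)"
proof -
  have "P_inv_op N n v = on_factor N n v (\<lambda>m k. if m = (k + (N - 1)) mod N then 1 else 0)"
    unfolding P_inv_op_def by (intro on_factor_cong assms) (simp only: Suc_mod_eq_iff)
  also have "\<dots> = monomial_mat (N ^ n) (shift_digit N n v (N - 1)) (\<lambda>c. 1)"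
    by (rule on_factor_monomial) (use assms in auto)
  finally show ?thesis .
qed

lemma U_op_power:
  assumes "N > 0" "v < n"
  shows "U_op N n v ^\<^sub>m i = monomial_mat (N ^ n) (\<lambda>c. c) (\<lambda>c. qroot N ^ (2 * i * digit N v c))"
proof (induction i)
  case 0
  have "(1\<^sub>m (N ^ n) :: complex Matrix.mat) = monomial_mat (N ^ n) (\<lambda>c. c) (\<lambda>c. 1)"
    by (rule eq_matI) auto
  then show ?case using assms by (simp add: U_op_monomial)
next
  case (Suc i)
  then show ?case
    using assms by (simp add: U_op_monomial monomial_mult) (simp add: power_add algebra_simps)
qed

lemma shift_shift:
  assumes "N > 0" "v < n"
  shows "shift_digit N n v i (shift_digit N n v j c) = shift_digit N n v (i + j) c"
proof (rule digit_eqI)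
  fix u assume "u < n"
  then show "digit N u (shift_digit N n v i (shift_digit N n v j c)) = digit N u (shift_digit N n v (i + j) c)"
    using assms by (simp add: digit_set_digit mod_simps add_ac)
qed (use assms in \<open>auto simp: set_digit_less\<close>)

lemma P_op_power:
  assumes "N > 0" "v < n"
  shows "P_op N n v ^\<^sub>m j = monomial_mat (N ^ n) (shift_digit N n v j) (\<lambda>c. 1)"
proof (induction j)
  case 0
  have "shift_digit N n v 0 c = c" if "c < N ^ n" for c
    using that assms by (simp add: digit_less set_digit_self)
  then have "(1\<^sub>m (N ^ n) :: complex Matrix.mat) = monomial_mat (N ^ n) (shift_digit N n v 0) (\<lambda>c. 1)"
    by (intro eq_matI) auto
  then show ?case using assms by (simp add: P_op_monomial)
next
  case (Suc j)
  have "P_op N n v ^\<^sub>m Suc j = monomial_mat (N ^ n) (shift_digit N n v j) (\<lambda>c. 1)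
      * monomial_mat (N ^ n) (shift_digit N n v 1) (\<lambda>c. 1)"
    using Suc P_op_monomial[OF assms] by simp
  also have "\<dots> = monomial_mat (N ^ n) (shift_digit N n v (Suc j)) (\<lambda>c. 1)"
    using assms by (simp add: monomial_mult set_digit_less shift_shift[OF assms, unfolded One_nat_def] del: One_nat_def) simp
  finally show ?case .
qed

text \<open>Truncated subtraction is harmless here, as digits are less than \<open>N\<close>.\<close>

definition subtract_digit :: "nat \<Rightarrow> nat \<Rightarrow> nat \<Rightarrow> nat \<Rightarrow> nat \<Rightarrow> nat" where
  "subtract_digit N n v w c = shift_digit N n v (N - digit N w c) c"

lemma subtract_digit_less: "N > 0 \<Longrightarrow> subtract_digit N n v w c < N ^ n"
  by (simp add: subtract_digit_def set_digit_less)

lemma digit_subtract_digit: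
  assumes "N > 0" "u < n"
  shows "digit N u (subtract_digit N n v w c)
    = (if u = v then (digit N v c + (N - digit N w c)) mod N else digit N u c)"
  using assms by (simp add: subtract_digit_def digit_set_digit)

lemma add_mod_cancel_right:
  fixes a b k N :: nat
  assumes "(a + k) mod N = (b + k) mod N" "a < N" "b < N"
  shows "a = b"
proof -
  \<comment> \<open>\<open>N * k - k\<close> is a natural number representing \<open>-k\<close>
    modulo \<open>N\<close>.\<close>
  have "(a + k + (N * k - k)) mod N = (b + k + (N * k - k)) mod N"
    using assms(1) by (rule mod_add_cong) simp
  moreover have "k + (N * k - k) = N * k" using assms(2) by (cases N) auto
  ultimately have "(a + N * k) mod N = (b + N * k) mod N" by (simp add: add.assoc)
  with assms show ?thesis by simp
qed

text \<open>Since \<open>v \<noteq> w\<close>, digit \<open>w\<close> survives unchanged; it tells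
  how much was subtracted, so digit \<open>v\<close> can be recovered.\<close>

lemma subtract_digit_inj:
  assumes "N > 0" "v < n" "w < n" "v \<noteq> w"
  shows "inj_on (subtract_digit N n v w) {..<N ^ n}"
proof (rule inj_onI)
  fix c c' assume c: "c \<in> {..<N ^ n}" "c' \<in> {..<N ^ n}"
    and eq: "subtract_digit N n v w c = subtract_digit N n v w c'"
  have other: "digit N u c = digit N u c'" if "u < n" "u \<noteq> v" for u
    using arg_cong[OF eq, of "digit N u"] assms(1) that by (simp add: digit_subtract_digit)
  have w: "digit N w c = digit N w c'" using assms by (intro other) auto
  have "digit N v c = digit N v c'"
  proof (rule add_mod_cancel_right)
    show "(digit N v c + (N - digit N w c)) mod N = (digit N v c' + (N - digit N w c)) mod N"
      using arg_cong[OF eq, of "digit N v"] assms(1,2) by (simp add: digit_subtract_digit flip: w)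
  qed (use assms(1) in \<open>simp_all add: digit_less\<close>)
  with other c show "c = c'" by (intro digit_eqI[of c N n]) auto
qed

text \<open>This is the permutation \<open>Q\<^sub>v\<^sub>w\<close>.\<close>

definition subtract_op :: "nat \<Rightarrow> nat \<Rightarrow> nat \<Rightarrow> nat \<Rightarrow> complex Matrix.mat" where
  "subtract_op N n v w = monomial_mat (N ^ n) (subtract_digit N n v w) (\<lambda>c. 1)"

lemma subtract_op_isometry:
  assumes "N > 0" "v < n" "w < n" "v \<noteq> w"
  shows "isometry (N ^ n) (subtract_op N n v w)"
  unfolding subtract_op_def
  using assms by (intro monomial_isometry subtract_digit_inj) (auto simp: subtract_digit_less)

text \<open>On a basis vector the sum over \<open>i\<close> is a character sum in
  \<open>j + digit N w c\<close>. It vanishes unless \<open>j\<close> is minus digit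
  \<open>w\<close> modulo \<open>N\<close>, so one power of \<open>P_op N n v\<close> survives, with
  coefficient 1 after division by \<open>N\<close>.\<close>

lemma fourier_sum_eq_subtract_op:
  assumes N: "odd N" and vw: "v < n" "w < n" "v \<noteq> w"
  shows "Matrix.mat (N ^ n) (N ^ n) (\<lambda>(r, c). 1 / of_nat N *
         (\<Sum>i<N. \<Sum>j<N. qroot N ^ (2 * i * j) * (U_op N n w ^\<^sub>m i * P_op N n v ^\<^sub>m j) $$ (r, c)))
    = subtract_op N n v w"
proof (rule eq_matI)
  fix r c assume "r < dim_row (subtract_op N n v w)" "c < dim_col (subtract_op N n v w)"
  then have rc: "r < N ^ n" "c < N ^ n" by (auto simp: subtract_op_def)
  have N0: "N > 0" using N by (rule odd_pos)
  let ?w = "digit N w c"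
  have entry: "(U_op N n w ^\<^sub>m i * P_op N n v ^\<^sub>m j) $$ (r, c)
      = (if r = shift_digit N n v j c then qroot N ^ (2 * i * ?w) else 0)" for i j
    using rc vw N0 by (simp add: U_op_power P_op_power monomial_mult set_digit_less digit_set_digit)
  have "(\<Sum>i<N. \<Sum>j<N. qroot N ^ (2 * i * j) * (U_op N n w ^\<^sub>m i * P_op N n v ^\<^sub>m j) $$ (r, c))
      = (\<Sum>j<N. \<Sum>i<N. qroot N ^ (2 * i * j) * (U_op N n w ^\<^sub>m i * P_op N n v ^\<^sub>m j) $$ (r, c))"
    by (rule sum.swap)
  also have "\<dots> = (\<Sum>j<N. if r = shift_digit N n v j c then \<Sum>i<N. qroot N ^ (2 * i * (j + ?w)) else 0)"
    unfolding entry by (intro sum.cong) (auto simp: power_add distrib_left)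
  also have "\<dots> = (\<Sum>j<N. if j = (N - ?w) mod N then (if r = shift_digit N n v j c then of_nat N else 0) else 0)"
  proof (rule sum.cong)
    fix j assume "j \<in> {..<N}"
    then have j: "j < N" by simp
    have "N dvd j + ?w \<longleftrightarrow> j = (N - ?w) mod N"
    proof
      assume "N dvd j + ?w"
      then have "(j + ?w) mod N = ((N - ?w) mod N + ?w) mod N"
        using digit_less[OF N0, of w c] by (simp add: mod_simps dvd_eq_mod_eq_0)
      then show "j = (N - ?w) mod N" by (rule add_mod_cancel_right) (use j N0 in auto)
    next
      assume "j = (N - ?w) mod N"
      then have "(j + ?w) mod N = 0"
        using digit_less[OF N0, of w c] by (simp add: mod_simps)
      then show "N dvd j + ?w" by (simp add: dvd_eq_mod_eq_0)
    qed
    then show "(if r = shift_digit N n v j c then \<Sum>i<N. qroot N ^ (2 * i * (j + ?w)) else 0)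
      = (if j = (N - ?w) mod N then (if r = shift_digit N n v j c then of_nat N else 0) else 0)"
      by (simp only: qroot_sum[OF N]) simp
  qed simp
  also have "\<dots> = (if r = subtract_digit N n v w c then of_nat N else 0)"
    using N0 by (simp add: subtract_digit_def mod_simps)
  finally show "Matrix.mat (N ^ n) (N ^ n) (\<lambda>(r, c). 1 / of_nat N *
         (\<Sum>i<N. \<Sum>j<N. qroot N ^ (2 * i * j) * (U_op N n w ^\<^sub>m i * P_op N n v ^\<^sub>m j) $$ (r, c))) $$ (r, c)
    = subtract_op N n v w $$ (r, c)"
    using rc N0 by (simp add: subtract_op_def)
qed (simp_all add: subtract_op_def)

section \<open>Unitarity of relabelings, dot rotations and the generators \<open>U\<close> and
  \<open>P\<close>\<close>

lemma relabel_isometry: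
  assumes "N > 0" "\<sigma> permutes {..<n}"
  shows "isometry (N ^ n) (relabel_op N n \<sigma>)"
proof -
  define \<tau> where "\<tau> = (\<lambda>c. assemble N n (\<lambda>i. digit N (\<sigma> i) c))"
  have less: "\<tau> c < N ^ n" for c
    unfolding \<tau>_def using assms(1) by (intro assemble_less) (simp add: digit_less)
  have dig: "digit N i (\<tau> c) = digit N (\<sigma> i) c" if "i < n" for i c
    unfolding \<tau>_def using assms(1) that by (intro digit_assemble) (simp_all add: digit_less)
  have "r = \<tau> c \<longleftrightarrow> (\<forall>i<n. digit N i r = digit N (\<sigma> i) c)" if "r < N ^ n" for r c
    using digit_eqI[OF that less] dig by auto
  then have "relabel_op N n \<sigma> = monomial_mat (N ^ n) \<tau> (\<lambda>c. 1)"
    by (intro eq_matI) (auto simp: relabel_op_def)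
  \<comment> \<open>Every factor has the form \<open>\<sigma> i\<close>, so no digit of
    \<open>c\<close> is lost.\<close>
  moreover have "inj_on \<tau> {..<N ^ n}"
  proof (rule inj_onI)
    fix c c' assume c: "c \<in> {..<N ^ n}" "c' \<in> {..<N ^ n}" and eq: "\<tau> c = \<tau> c'"
    show "c = c'"
    proof (rule digit_eqI[of c N n])
      fix u assume "u < n"
      then have "u \<in> \<sigma> ` {..<n}" using permutes_image[OF assms(2)] by simp
      then obtain i where "i < n" "\<sigma> i = u" by auto
      then show "digit N u c = digit N u c'" using eq dig by metis
    qed (use c in auto)
  qed
  ultimately show ?thesis using less by (simp add: monomial_isometry)
qed

text \<open>The Gaussian factors and the constant phase have modulus 1 and cancel in the inner
  product of two columns. What remains is the orthogonality of the discrete Fourier transform, with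
  normalization \<open>1 / N\<close>.\<close>

lemma A_op_isometry:
  assumes N: "odd N" and v: "v < n"
  shows "isometry (N ^ n) (A_op N n v)"
  unfolding A_op_def
proof (rule on_factor_isometry[OF odd_pos[OF N] v])
  fix m k assume mk: "m < N" "k < N"
  let ?q = "qroot N"
  define C where "C = complex_of_real (1 / sqrt N) * exp (pi * \<i> / 2 * ((1 - of_nat N) / 6))"
  have "cmod (exp (pi * \<i> / 2 * ((1 - of_nat N) / 6))) = 1"
    by simp
  then have "cmod C = 1 / sqrt N" by (simp add: C_def norm_mult norm_divide)
  then have C: "cnj C * C = 1 / of_nat N"
    using complex_norm_square[of C] by (simp add: mult.commute power_divide flip: of_real_power)
  have z: "(?q ^ (2 * m) / ?q ^ (2 * k)) ^ N = 1"
    unfolding power_divide by (metis mult.commute power_mult power_one qroot_power[OF N] div_by_1)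
  have z1: "?q ^ (2 * m) / ?q ^ (2 * k) = 1 \<longleftrightarrow> m = k"
    using qroot_even_eq_iff[OF N, of m k] mk by simp
  have "(\<Sum>j<N. cnj (C * inverse (?q ^ (j ^ 2)) * inverse (?q ^ (2 * m * j)))
      * (C * inverse (?q ^ (j ^ 2)) * inverse (?q ^ (2 * k * j))))
    = (\<Sum>j<N. 1 / of_nat N * (?q ^ (2 * m) / ?q ^ (2 * k)) ^ j)"
  proof (rule sum.cong)
    fix j
    have "cnj (C * inverse (?q ^ (j ^ 2)) * inverse (?q ^ (2 * m * j)))
        * (C * inverse (?q ^ (j ^ 2)) * inverse (?q ^ (2 * k * j)))
      = (cnj C * C) * (?q ^ (2 * m * j) / ?q ^ (2 * k * j))"
      by (simp add: field_simps power_inverse)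
    also have "\<dots> = 1 / of_nat N * (?q ^ (2 * m) / ?q ^ (2 * k)) ^ j"
      by (simp add: C power_divide power_mult)
    finally show "cnj (C * inverse (?q ^ (j ^ 2)) * inverse (?q ^ (2 * m * j)))
      * (C * inverse (?q ^ (j ^ 2)) * inverse (?q ^ (2 * k * j))) = \<dots>" .
  qed simp
  also have "\<dots> = 1 / of_nat N * (\<Sum>j<N. (?q ^ (2 * m) / ?q ^ (2 * k)) ^ j)"
    by (simp only: sum_distrib_left)
  also have "\<dots> = (if m = k then 1 else 0)"
    using odd_pos[OF N] by (simp only: sum_powers_root_unity[OF z] z1) simp
  finally show "(\<Sum>j<N. cnj (complex_of_real (1 / sqrt N) * exp (pi * \<i> / 2 * ((1 - of_nat N) / 6))
       * inverse (?q ^ (j ^ 2)) * inverse (?q ^ (2 * m * j)))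
       * (complex_of_real (1 / sqrt N) * exp (pi * \<i> / 2 * ((1 - of_nat N) / 6))
       * inverse (?q ^ (j ^ 2)) * inverse (?q ^ (2 * k * j)))) = (if m = k then 1 else 0)"
    unfolding C_def .
qed

lemma shift_digit_inj:
  assumes "N > 0" "v < n"
  shows "inj_on (shift_digit N n v j) {..<N ^ n}"
proof (rule inj_onI)
  fix c c' assume c: "c \<in> {..<N ^ n}" "c' \<in> {..<N ^ n}"
    and eq: "shift_digit N n v j c = shift_digit N n v j c'"
  have "digit N u c = digit N u c'" if "u < n" for u
  proof (cases "u = v")
    case True
    have "digit N v c = digit N v c'"
    proof (rule add_mod_cancel_right)
      show "(digit N v c + j) mod N = (digit N v c' + j) mod N"
        using arg_cong[OF eq, of "digit N v"] assms by (simp add: digit_set_digit)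
    qed (use assms(1) in \<open>simp_all add: digit_less\<close>)
    then show ?thesis by (simp add: True)
  next
    case False
    then show ?thesis
      using arg_cong[OF eq, of "digit N u"] assms that by (simp add: digit_set_digit)
  qed
  with c show "c = c'" by (intro digit_eqI[of c N n]) auto
qed

lemma U_op_isometry: "N > 0 \<Longrightarrow> v < n \<Longrightarrow> isometry (N ^ n) (U_op N n v)"
  by (simp add: U_op_monomial monomial_isometry norm_power)

lemma P_op_isometry: "N > 0 \<Longrightarrow> v < n \<Longrightarrow> isometry (N ^ n) (P_op N n v)"
  unfolding P_op_monomial
  by (intro monomial_isometry shift_digit_inj) (auto simp: set_digit_less)

lemma P_inv_op_isometry: "N > 0 \<Longrightarrow> v < n \<Longrightarrow> isometry (N ^ n) (P_inv_op N n v)"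
  unfolding P_inv_op_monomial
  by (intro monomial_isometry shift_digit_inj) (auto simp: set_digit_less)

section \<open>The Weyl ordered argument of the dilogarithm\<close>

text \<open>For odd \<open>N\<close>, 2 is invertible modulo the order of
  \<open>qroot N\<close>.\<close>

lemma qroot_powi_half:
  assumes "odd N" "qroot N powi (2 * e) = qroot N powi (2 * e')"
  shows "qroot N powi e = qroot N powi e'"
proof -
  obtain m where m: "N = 2 * m + 1" using assms(1) by (elim oddE)
  \<comment> \<open>\<open>m + 1\<close> is the inverse of 2 modulo \<open>2 * m + 1\<close>; the
    correction by \<open>int N * - e\<close> makes the exponent exactly \<open>e\<close>.\<close>
  have half: "qroot N powi e = (qroot N powi (2 * e)) powi (int m + 1)" for e
  proof -
    have "qroot N powi (int N * - e) = 1"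
      unfolding power_int_mult by (simp add: qroot_power[OF assms(1)])
    then have "(qroot N powi (2 * e)) powi (int m + 1)
        = qroot N powi (2 * e * (int m + 1)) * qroot N powi (int N * - e)"
      by (simp add: power_int_mult)
    also have "\<dots> = qroot N powi (2 * e * (int m + 1) + int N * - e)"
      by (rule power_int_add[symmetric]) simp
    also have "2 * e * (int m + 1) + int N * - e = e"
      unfolding m by (simp add: algebra_simps)
    finally show ?thesis ..
  qed
  show ?thesis using half[of e] half[of e'] assms(2) by simp
qed

text \<open>Multiplication by \<open>adj K\<close> reduces the claim to multiples of the identity,
  which has an entry 1 as \<open>d > 0\<close>.\<close>

lemma isometry_smult_cancel:
  assumes "isometry d K" "d > 0" "x \<cdot>\<^sub>m K = y \<cdot>\<^sub>m K"
  shows "x = y"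
proof -
  have K: "K \<in> carrier_mat d d" "adj K * K = 1\<^sub>m d" using assms(1) by (simp_all add: isometry_def)
  have "adj K * (z \<cdot>\<^sub>m K) = z \<cdot>\<^sub>m 1\<^sub>m d" for z
    using mult_smult_distrib[OF adj_carrier[OF K(1)] K(1)] K(2) by simp
  then have "x \<cdot>\<^sub>m 1\<^sub>m d = y \<cdot>\<^sub>m 1\<^sub>m d" using assms(3) by metis
  then have "(x \<cdot>\<^sub>m 1\<^sub>m d) $$ (0, 0) = (y \<cdot>\<^sub>m 1\<^sub>m d) $$ (0, 0)" by simp
  with assms(2) show ?thesis by simp
qed

text \<open>\<open>weyl_exponent\<close> is an arbitrary choice, but invertibility of
  \<open>B * A\<close> fixes the power of \<open>qroot N\<close> with doubled exponent, and oddness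
  of \<open>N\<close> then fixes the power itself.\<close>

lemma weyl_exponent_powi:
  assumes "odd N" "d > 0" "isometry d A" "isometry d B"
    and comm: "A * B = qroot N powi (2 * e) \<cdot>\<^sub>m (B * A)"
  shows "qroot N powi weyl_exponent N A B = qroot N powi e"
proof (rule qroot_powi_half[OF assms(1)])
  have "A * B = qroot N powi (2 * weyl_exponent N A B) \<cdot>\<^sub>m (B * A)"
    unfolding weyl_exponent_def by (rule someI) (rule comm)
  with comm show "qroot N powi (2 * weyl_exponent N A B) = qroot N powi (2 * e)"
    by (intro isometry_smult_cancel[OF isometry_mult[OF assms(4,3)] assms(2)]) simp
qed

text \<open>Of the three pairs only the first fails to commute: exchanging its members costs the
  square of \<open>qroot N\<close>, so the ordering contributes the single factor
  \<open>inverse (qroot N)\<close>.\<close>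

lemma weyl_product_monomial:
  assumes N: "odd N" and vw: "v < n" "w < n" "v \<noteq> w"
  shows "weyl_product N [P_inv_op N n v, U_op N n v, P_op N n w]
    = monomial_mat (N ^ n) (\<lambda>c. shift_digit N n v (N - 1) (shift_digit N n w 1 c))
        (\<lambda>c. inverse (qroot N) * qroot N ^ (2 * digit N v c))"
proof -
  have N0: "N > 0" using N by (rule odd_pos)
  have d0: "N ^ n > 0" using N0 by simp
  note mono = P_inv_op_monomial[OF N0 vw(1)] U_op_monomial[OF N0 vw(1)] P_op_monomial[OF N0 vw(2)]
  note iso = P_inv_op_isometry[OF N0 vw(1)] U_op_isometry[OF N0 vw(1)] P_op_isometry[OF N0 vw(2)]
  \<comment> \<open>Lowering digit \<open>v\<close> by one divides the eigenvalue of
    \<open>U_op N n v\<close> by \<open>qroot N ^ 2\<close>, also when the digit wraps from 0 to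
    \<open>N - 1\<close>.\<close>
  have q2: "qroot N ^ (2 * digit N v c)
      = qroot N powi 2 * qroot N ^ (2 * ((digit N v c + (N - 1)) mod N))" for c
  proof -
    have "qroot N powi 2 * qroot N ^ (2 * ((digit N v c + (N - 1)) mod N))
        = qroot N ^ (2 + 2 * ((digit N v c + (N - 1)) mod N))"
      by (simp only: power_add power_int_numeral)
    also have "\<dots> = qroot N ^ (2 * digit N v c)"
    proof (rule qroot_cong[OF N])
      have "(2 + 2 * ((digit N v c + (N - 1)) mod N)) mod N = (2 + 2 * (digit N v c + (N - 1))) mod N"
        by (intro mod_add_cong refl mod_mult_right_eq)
      also have "2 + 2 * (digit N v c + (N - 1)) = 2 * digit N v c + 2 * N" using N0 by simp
      also have "(2 * digit N v c + 2 * N) mod N = (2 * digit N v c) mod N" by simp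
      finally show "(2 + 2 * ((digit N v c + (N - 1)) mod N)) mod N = (2 * digit N v c) mod N" .
    qed
    finally show ?thesis ..
  qed
  have q2': "qroot N ^ 2 * qroot N ^ (2 * ((digit N v c + N - Suc 0) mod N))
      = qroot N ^ (2 * digit N v c)" for c
    using q2[of c] N0 by simp
  have "P_inv_op N n v * U_op N n v = qroot N powi (2 * 1) \<cdot>\<^sub>m (U_op N n v * P_inv_op N n v)"
    unfolding mono using N0 vw
    by (simp add: monomial_mult monomial_smult set_digit_less digit_set_digit q2')
  then have e1: "qroot N powi weyl_exponent N (P_inv_op N n v) (U_op N n v) = qroot N powi 1"
    by (intro weyl_exponent_powi[OF N d0] iso)
  have swap: "shift_digit N n v (N - 1) (shift_digit N n w 1 c)
      = shift_digit N n w 1 (shift_digit N n v (N - 1) c)" for c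
    by (rule digit_eqI[of _ N n]) (use N0 vw in \<open>auto simp: set_digit_less digit_set_digit\<close>)
  have "P_inv_op N n v * P_op N n w = qroot N powi (2 * 0) \<cdot>\<^sub>m (P_op N n w * P_inv_op N n v)"
    unfolding mono using N0 swap
    by (simp add: monomial_mult monomial_smult set_digit_less)
  then have e2: "qroot N powi weyl_exponent N (P_inv_op N n v) (P_op N n w) = qroot N powi 0"
    by (intro weyl_exponent_powi[OF N d0] iso)
  have "U_op N n v * P_op N n w = qroot N powi (2 * 0) \<cdot>\<^sub>m (P_op N n w * U_op N n v)"
    unfolding mono using N0 vw
    by (simp add: monomial_mult monomial_smult set_digit_less digit_set_digit)
  then have e3: "qroot N powi weyl_exponent N (U_op N n v) (P_op N n w) = qroot N powi 0"
    by (intro weyl_exponent_powi[OF N d0] iso)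
  have set: "{(i, j). i < j \<and> j < length [P_inv_op N n v, U_op N n v, P_op N n w]}
      = {(0, 1), (0, 2), (1, 2)}"
    by (auto simp: less_Suc_eq numeral_2_eq_2)
  have "qroot N powi (- (\<Sum>(i, j)\<in>{(0::nat, 1::nat), (0, 2), (1, 2)}.
      weyl_exponent N ([P_inv_op N n v, U_op N n v, P_op N n w] ! i)
        ([P_inv_op N n v, U_op N n v, P_op N n w] ! j))) = inverse (qroot N)"
    by (simp add: power_int_minus power_int_diff power_int_add e1 e2 e3 divide_simps)
  then have "weyl_product N [P_inv_op N n v, U_op N n v, P_op N n w]
      = inverse (qroot N) \<cdot>\<^sub>m (P_inv_op N n v * (U_op N n v * (P_op N n w * 1\<^sub>m (N ^ n))))"
    unfolding weyl_product_def set by (simp add: P_inv_op_def)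
  also have "P_op N n w * 1\<^sub>m (N ^ n) = P_op N n w"
    by (rule right_mult_one_mat[where nr = "N ^ n"]) (simp add: P_op_def)
  finally show ?thesis
    unfolding mono using N0 vw
    by (simp add: monomial_mult monomial_smult set_digit_less digit_set_digit)
qed

text \<open>Lowering digit \<open>v\<close> by one before it is subtracted from digit
  \<open>w\<close> raises the result by one. This accounts for the shift of \<open>w\<close> on the
  left, so after conjugation only factor \<open>v\<close> is involved; the weights agree because
  digit \<open>v\<close> is not changed by the subtraction.\<close>

lemma weyl_subtract_intertwine:
  assumes N: "N > 0" and vw: "v < n" "w < n" "v \<noteq> w"
  shows "monomial_mat (N ^ n) (\<lambda>c. shift_digit N n v (N - 1) (shift_digit N n w 1 c))
        (\<lambda>c. x * y ^ (2 * digit N v c)) * subtract_op N n w v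
    = subtract_op N n w v
      * monomial_mat (N ^ n) (shift_digit N n v (N - 1)) (\<lambda>c. x * y ^ (2 * digit N v c))"
proof -
  have "shift_digit N n v (N - 1) (shift_digit N n w 1 (subtract_digit N n w v c))
      = subtract_digit N n w v (shift_digit N n v (N - 1) c)" (is "?l = ?r") for c
  proof (rule digit_eqI)
    fix u assume u: "u < n"
    have "(digit N w c + (N - digit N v c) + 1) mod N
        = (digit N w c + (N - (digit N v c + (N - 1)) mod N)) mod N"
    \<comment> \<open>At a nonzero digit the shift is the ordinary predecessor and both sides agree
      before reduction; at 0 it wraps to \<open>N - 1\<close>.\<close>
    proof (cases "digit N v c = 0")
      case False
      then have "(digit N v c + (N - 1)) mod N = digit N v c - 1"
        using digit_less[OF N, of v c] by (simp add: mod_if)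
      moreover have "digit N w c + (N - digit N v c) + 1 = digit N w c + (N - (digit N v c - 1))"
        using False digit_less[OF N, of v c] by simp
      ultimately show ?thesis by (simp only:)
    qed (use N in \<open>simp flip: add_Suc\<close>)
    then show "digit N u ?l = digit N u ?r"
      using N vw u by (simp add: digit_set_digit digit_subtract_digit mod_simps)
  qed (use N in \<open>simp_all add: set_digit_less subtract_digit_less\<close>)
  then show ?thesis
    unfolding subtract_op_def using N vw
    by (simp add: monomial_mult set_digit_less subtract_digit_less digit_subtract_digit)
qed

text \<open>Completing the square: with \<open>q = qroot N\<close>, passing from row
  \<open>m\<close> to \<open>m + 1\<close> multiplies the entry in column \<open>k\<close> by the
  inverse of \<open>q ^ (2 * m + 1 + 2 * k)\<close>. The weight at \<open>m + 1\<close> is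
  \<open>q ^ (2 * m + 1)\<close>, so exactly the inverse of \<open>q ^ (2 * k)\<close> is
  left.\<close>

lemma A_op_intertwine:
  assumes N: "odd N" and v: "v < n"
  shows "monomial_mat (N ^ n) (shift_digit N n v (N - 1))
      (\<lambda>c. inverse (qroot N) * qroot N ^ (2 * digit N v c)) * A_op N n v
    = A_op N n v * mat_diag (N ^ n) (\<lambda>c. inverse (qroot N ^ (2 * digit N v c)))"
proof -
  let ?q = "qroot N"
  have N0: "N > 0" using N by (rule odd_pos)
  define C where "C = complex_of_real (1 / sqrt N) * exp (pi * \<i> / 2 * ((1 - of_nat N) / 6))"
  define a where "a = (\<lambda>m k :: nat. C * inverse (?q ^ (m ^ 2)) * inverse (?q ^ (2 * k * m)))"
  have A: "A_op N n v = on_factor N n v a"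
    by (simp add: A_op_def a_def C_def)
  \<comment> \<open>Periodicity in the row index lets \<open>m + 1\<close> be used without reduction
    modulo \<open>N\<close>.\<close>
  have per: "a (m mod N) k = a m k" for m k
  proof -
    have "?q ^ ((m mod N) ^ 2) = ?q ^ (m ^ 2)" by (rule qroot_cong[OF N]) (rule power_mod)
    moreover have "?q ^ (2 * k * (m mod N)) = ?q ^ (2 * k * m)"
      by (rule qroot_cong[OF N]) (rule mod_mult_right_eq)
    ultimately show ?thesis by (simp add: a_def)
  qed
  have "monomial_mat (N ^ n) (shift_digit N n v (N - 1)) (\<lambda>c. inverse ?q * ?q ^ (2 * digit N v c))
      = on_factor N n v (\<lambda>m k. if m = (k + (N - 1)) mod N then inverse ?q * ?q ^ (2 * k) else 0)"
    by (rule on_factor_monomial[symmetric]) (use N0 v in auto)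
  then have "monomial_mat (N ^ n) (shift_digit N n v (N - 1)) (\<lambda>c. inverse ?q * ?q ^ (2 * digit N v c))
        * A_op N n v
      = on_factor N n v (\<lambda>m k. \<Sum>j<N. (if m = (j + (N - 1)) mod N then inverse ?q * ?q ^ (2 * j) else 0) * a j k)"
    by (simp only: A on_factor_mult[OF N0 v])
  also have "\<dots> = on_factor N n v (\<lambda>m k. \<Sum>j<N. a m j * (if j = k then inverse (?q ^ (2 * k)) else 0))"
  proof (rule on_factor_cong[OF N0])
    fix m k assume mk: "m < N" "k < N"
    have "(\<Sum>j<N. (if m = (j + (N - 1)) mod N then inverse ?q * ?q ^ (2 * j) else 0) * a j k)
        = (\<Sum>j<N. if j = (m + 1) mod N then inverse ?q * ?q ^ (2 * j) * a j k else 0)"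
      using Suc_mod_eq_iff[OF mk(1)] by (intro sum.cong) auto
    also have "\<dots> = inverse ?q * ?q ^ (2 * ((m + 1) mod N)) * a ((m + 1) mod N) k"
      using N0 by simp
    also have "?q ^ (2 * ((m + 1) mod N)) = ?q ^ (2 * (m + 1))"
      by (rule qroot_cong[OF N]) (rule mod_mult_right_eq)
    also have "inverse ?q * ?q ^ (2 * (m + 1)) * a ((m + 1) mod N) k = a m k * inverse (?q ^ (2 * k))"
      unfolding per by (simp add: a_def field_simps power_add power2_eq_square mult_2_right)
    also have "\<dots> = (\<Sum>j<N. if j = k then a m k * inverse (?q ^ (2 * k)) else 0)"
      using mk by simp
    also have "\<dots> = (\<Sum>j<N. a m j * (if j = k then inverse (?q ^ (2 * k)) else 0))"
      by (intro sum.cong) auto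
    finally show "(\<Sum>j<N. (if m = (j + (N - 1)) mod N then inverse ?q * ?q ^ (2 * j) else 0) * a j k) = \<dots>" .
  qed
  also have "\<dots> = on_factor N n v a * on_factor N n v (\<lambda>m k. if m = k then inverse (?q ^ (2 * k)) else 0)"
    by (simp only: on_factor_mult[OF N0 v])
  finally show ?thesis by (simp only: A on_factor_diag[OF N0 v])
qed

section \<open>Functions of a diagonalizable operator\<close>

lemma mat_diag_mult_vec:
  assumes "y \<in> carrier_vec d"
  shows "mat_diag d g *\<^sub>v y = Matrix.vec d (\<lambda>i. g i * vec_index y i)"
proof (rule eq_vecI)
  fix i assume "i < dim_vec (Matrix.vec d (\<lambda>i. g i * vec_index y i))"
  then have i: "i < d" by simp
  have "vec_index (mat_diag d g *\<^sub>v y) i = (\<Sum>j<d. (if i = j then g j else 0) * vec_index y j)"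
    using assms i unfolding mat_diag_def
    by (auto simp: scalar_prod_def atLeast0LessThan intro!: sum.cong)
  also have "\<dots> = (\<Sum>j<d. if j = i then g i * vec_index y i else 0)"
    by (intro sum.cong) auto
  finally show "vec_index (mat_diag d g *\<^sub>v y) i = vec_index (Matrix.vec d (\<lambda>i. g i * vec_index y i)) i"
    using i by simp
qed (simp add: mat_diag_def)

lemma det_mat_diag: "Determinant.det (mat_diag d g) = (\<Prod>i<d. g i)" for g :: "nat \<Rightarrow> complex"
proof -
  have "Determinant.det (mat_diag d g) = prod_list (diag_mat (mat_diag d g))"
    by (rule Determinant.det_upper_triangular[of _ d]) (auto simp: mat_diag_def)
  also have "diag_mat (mat_diag d g) = map g [0..<d]"
    by (simp add: diag_mat_def mat_diag_def)
  also have "prod_list \<dots> = (\<Prod>i<d. g i)"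
    by (simp add: prod.distinct_set_conv_list[symmetric] atLeast0LessThan)
  finally show ?thesis .
qed

text \<open>The columns of \<open>S\<close> form an eigenbasis of \<open>X\<close> with eigenvalues
  among those prescribed by \<open>apply_fun\<close>; this gives both existence and uniqueness of
  the operator described there.\<close>

lemma apply_fun_diagonalizable:
  assumes X: "X \<in> carrier_mat d d" and S: "S \<in> carrier_mat d d" and T: "T \<in> carrier_mat d d"
    and inv: "S * T = 1\<^sub>m d" "T * S = 1\<^sub>m d"
    and e: "\<And>c. c < d \<Longrightarrow> e c < N"
    and XS: "X * S = S * mat_diag d (\<lambda>c. qroot N ^ (2 * e c))"
  shows "apply_fun N f X = S * mat_diag d (\<lambda>c. f (qroot N ^ (2 * e c))) * T"
  unfolding apply_fun_def
proof (rule the_equality)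
  let ?q = "qroot N"
  define L where "L = mat_diag d (\<lambda>c. ?q ^ (2 * e c))"
  define E where "E = mat_diag d (\<lambda>c. f (?q ^ (2 * e c)))"
  have L: "L \<in> carrier_mat d d" and E: "E \<in> carrier_mat d d" by (simp_all add: L_def E_def)
  note XS = XS[folded L_def]
  \<comment> \<open>Existence: in the coordinates \<open>y = T x\<close> both operators are
    diagonal.\<close>
  show "S * E * T \<in> carrier_mat (dim_row X) (dim_row X) \<and>
      (\<forall>k<N. \<forall>x\<in>carrier_vec (dim_row X). X *\<^sub>v x = ?q ^ (2 * k) \<cdot>\<^sub>v x \<longrightarrow>
        S * E * T *\<^sub>v x = f (?q ^ (2 * k)) \<cdot>\<^sub>v x)"
  proof (intro conjI allI impI ballI)
    fix k x assume "k < N" and "x \<in> carrier_vec (dim_row X)" and eig: "X *\<^sub>v x = ?q ^ (2 * k) \<cdot>\<^sub>v x"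
    then have x: "x \<in> carrier_vec d" using X by simp
    define y where "y = T *\<^sub>v x"
    have y: "y \<in> carrier_vec d" using T x by (simp add: y_def)
    have Sy: "S *\<^sub>v y = x"
      unfolding y_def using assoc_mult_mat_vec[OF S T x] inv x by simp
    have "L *\<^sub>v y = T *\<^sub>v (S *\<^sub>v (L *\<^sub>v y))"
      using assoc_mult_mat_vec[OF T S, of "L *\<^sub>v y"] inv L y by simp
    also have "S *\<^sub>v (L *\<^sub>v y) = X *\<^sub>v (S *\<^sub>v y)"
      using assoc_mult_mat_vec[OF S L y] assoc_mult_mat_vec[OF X S y] XS by simp
    also have "\<dots> = ?q ^ (2 * k) \<cdot>\<^sub>v x" unfolding Sy by (rule eig)
    also have "T *\<^sub>v (?q ^ (2 * k) \<cdot>\<^sub>v x) = ?q ^ (2 * k) \<cdot>\<^sub>v y"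
      unfolding y_def using T x by (rule mult_mat_vec)
    finally have Ly: "L *\<^sub>v y = ?q ^ (2 * k) \<cdot>\<^sub>v y" .
    have "E *\<^sub>v y = f (?q ^ (2 * k)) \<cdot>\<^sub>v y"
    proof (rule eq_vecI)
      fix c assume "c < dim_vec (f (?q ^ (2 * k)) \<cdot>\<^sub>v y)"
      then have c: "c < d" using y by simp
      have "vec_index (L *\<^sub>v y) c = vec_index (?q ^ (2 * k) \<cdot>\<^sub>v y) c" using Ly by simp
      \<comment> \<open>An eigenvector has nonzero coordinates only where the diagonal entry is its
        eigenvalue, and there \<open>E\<close> acts by the required scalar.\<close>
      then have "?q ^ (2 * e c) = ?q ^ (2 * k) \<or> vec_index y c = 0"
        using c y unfolding L_def mat_diag_mult_vec[OF y] by auto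
      then show "vec_index (E *\<^sub>v y) c = vec_index (f (?q ^ (2 * k)) \<cdot>\<^sub>v y) c"
        using c y unfolding E_def mat_diag_mult_vec[OF y] by auto
    qed (use y E in simp)
    have "S * E * T *\<^sub>v x = S *\<^sub>v (E *\<^sub>v y)"
      using assoc_mult_mat_vec[OF mult_carrier_mat[OF S E] T x] assoc_mult_mat_vec[OF S E y]
      by (simp add: y_def)
    also have "\<dots> = f (?q ^ (2 * k)) \<cdot>\<^sub>v x"
      unfolding \<open>E *\<^sub>v y = _\<close> using mult_mat_vec[OF S y] Sy by simp
    finally show "S * E * T *\<^sub>v x = f (?q ^ (2 * k)) \<cdot>\<^sub>v x" .
  qed (use X S E T in simp)
  \<comment> \<open>Uniqueness: the condition determines \<open>M\<close> on the columns of
    \<open>S\<close>, and \<open>S\<close> is invertible. Here \<open>e c < N\<close> ensures that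
    each column is covered by the condition.\<close>
  fix M assume M: "M \<in> carrier_mat (dim_row X) (dim_row X) \<and>
      (\<forall>k<N. \<forall>x\<in>carrier_vec (dim_row X). X *\<^sub>v x = ?q ^ (2 * k) \<cdot>\<^sub>v x \<longrightarrow>
        M *\<^sub>v x = f (?q ^ (2 * k)) \<cdot>\<^sub>v x)"
  then have Mc: "M \<in> carrier_mat d d" using X by simp
  have colS: "col (S * mat_diag d g) c = g c \<cdot>\<^sub>v col S c" if "c < d" for g c
    using S that by (intro eq_vecI) (auto simp: mat_diag_mult_right[OF S])
  have "M * S = S * E"
  proof (rule mat_col_eqI)
    fix c assume "c < dim_col (S * E)"
    then have c: "c < d" using E by simp
    have cc: "col S c \<in> carrier_vec d" using S c by simp
    have "X *\<^sub>v col S c = col (X * S) c" using X S c by (simp add: col_mult2)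
    also have "\<dots> = ?q ^ (2 * e c) \<cdot>\<^sub>v col S c" unfolding XS L_def by (rule colS[OF c])
    finally have "M *\<^sub>v col S c = f (?q ^ (2 * e c)) \<cdot>\<^sub>v col S c"
      using M e[OF c] cc X by auto
    then show "col (M * S) c = col (S * E) c"
      using Mc S c colS[OF c] by (simp add: col_mult2 E_def)
  qed (use Mc S E in auto)
  then have "M * S * T = S * E * T" by simp
  moreover have "M * S * T = M" using assoc_mult_mat[OF Mc S T] inv Mc by simp
  ultimately show "M = S * E * T" by simp
qed

text \<open>Raising to the power \<open>N\<close> removes the ambiguity of the branch: the value at
  a root of unity then depends only on the endpoint \<open>p\<close> of the path of
  continuation.\<close>

lemma dilog_branch_norm_prod:
  assumes N: "odd N" and br: "dilog_branch N p f"
  shows "(\<Prod>k<N. cmod (f (qroot N ^ (2 * k)))) = 1"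
proof -
  let ?q = "qroot N"
  have N0: "N > 0" using N by (rule odd_pos)
  obtain \<gamma> F where g: "path_image \<gamma> \<subseteq> fermat_bar N" "pathfinish \<gamma> = p"
    and all: "\<forall>X. X ^ N = 1 \<longrightarrow> continuous_on {0..1} (\<lambda>t. F t X)
          \<and> (\<exists>e>0. \<forall>t\<in>{0..1}. t < e \<longrightarrow> F t X = dilog_principal N (\<gamma> t) X)
          \<and> (\<forall>t\<in>{0..1}. F t X ^ N =
               (\<Prod>j<N. (snd (\<gamma> t) + ?q ^ (2 * j + 1) * fst (\<gamma> t) * X) ^ j))
          \<and> F 1 X = f X"
    using br unfolding dilog_branch_def by (elim exE conjE)
  have p1: "\<gamma> 1 = p" using g(2) by (simp add: pathfinish_def)
  have "p \<in> fermat_bar N" using g pathfinish_in_path_image by blast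
  \<comment> \<open>The added point \<open>(0, 1)\<close> satisfies the Fermat equation as
    well.\<close>
  then have curve: "fst p ^ N + snd p ^ N = 1"
    using N0 by (auto simp: fermat_bar_def fermat_def)
  have root: "(?q ^ (2 * k)) ^ N = 1" for k
    by (metis mult.commute power_mult power_one qroot_power[OF N])
  have fN: "f X ^ N = (\<Prod>j<N. (snd p + ?q ^ (2 * j + 1) * fst p * X) ^ j)" if "X ^ N = 1" for X
  proof -
    have "F 1 X = f X" "\<forall>t\<in>{0..1}. F t X ^ N =
        (\<Prod>j<N. (snd (\<gamma> t) + ?q ^ (2 * j + 1) * fst (\<gamma> t) * X) ^ j)"
      using all that by blast+
    from bspec[OF this(2), of 1] this(1) p1 show ?thesis by simp
  qed
  have "(\<Prod>k<N. f (?q ^ (2 * k))) ^ N = (\<Prod>k<N. f (?q ^ (2 * k)) ^ N)"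
    by (rule prod_power_distrib)
  also have "\<dots> = (\<Prod>k<N. \<Prod>j<N. (snd p + ?q ^ (2 * j + 1) * fst p * ?q ^ (2 * k)) ^ j)"
    by (simp only: fN[OF root])
  also have "\<dots> = (\<Prod>j<N. \<Prod>k<N. (snd p + ?q ^ (2 * j + 1) * fst p * ?q ^ (2 * k)) ^ j)"
    by (rule prod.swap)
  \<comment> \<open>For fixed \<open>j\<close> the even powers trade places: \<open>k\<close> now
    runs through the odd powers, and \<open>?q ^ (2 * j) * fst p\<close> replaces
    \<open>fst p\<close> in the factorization of the Fermat equation.\<close>
  also have "\<dots> = (\<Prod>j<N. (\<Prod>k<N. snd p + ?q ^ (2 * k + 1) * (?q ^ (2 * j) * fst p)) ^ j)"
    by (simp add: prod_power_distrib mult_ac)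
  also have "\<dots> = (\<Prod>j<N. ((?q ^ (2 * j) * fst p) ^ N + snd p ^ N) ^ j)"
    by (simp only: qroot_prod[OF N])
  also have "\<dots> = 1"
    by (simp only: power_mult_distrib root mult_1 curve power_one prod.neutral_const)
  finally have "cmod (\<Prod>k<N. f (?q ^ (2 * k))) ^ N = 1" by (metis norm_one norm_power)
  then have "cmod (\<Prod>k<N. f (?q ^ (2 * k))) = 1"
    using N0 by (intro power_eq_imp_eq_base[of _ N 1]) simp_all
  then show ?thesis by (simp add: prod_norm)
qed

lemma prod_digit_eq_1:
  fixes g :: "nat \<Rightarrow> real"
  assumes N: "N > 0" and v: "v < n" and g: "\<And>k. 0 \<le> g k" "(\<Prod>k<N. g k) = 1"
  shows "(\<Prod>c<N ^ n. g (digit N v c)) = 1"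
proof -
  \<comment> \<open>The product is invariant under all \<open>N\<close> shifts of digit \<open>v\<close>, so its \<open>N\<close>-th power
    can be evaluated by multiplying over the shifts first.\<close>
  have shift: "(\<Prod>c<N ^ n. g (digit N v c)) = (\<Prod>c<N ^ n. g ((digit N v c + j) mod N))" for j
  proof -
    have "bij_betw (shift_digit N n v j) {..<N ^ n} {..<N ^ n}"
      unfolding bij_betw_def using N
      by (intro conjI endo_inj_surj shift_digit_inj v) (auto simp: set_digit_less)
    from prod.reindex_bij_betw[OF this, of "\<lambda>c. g (digit N v c)"] show ?thesis
      using N v by (simp add: digit_set_digit)
  qed
  have cyc: "(\<Prod>j<N. g ((a + j) mod N)) = 1" for a
  proof -
    have "inj_on (\<lambda>j. (a + j) mod N) {..<N}"
    proof (rule inj_onI)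
      fix i j assume "i \<in> {..<N}" "j \<in> {..<N}" "(a + i) mod N = (a + j) mod N"
      then show "i = j" by (intro add_mod_cancel_right[of i a N j]) (simp_all add: add.commute)
    qed
    then have "bij_betw (\<lambda>j. (a + j) mod N) {..<N} {..<N}"
      unfolding bij_betw_def using N by (intro conjI endo_inj_surj) auto
    from prod.reindex_bij_betw[OF this, of g] g(2) show ?thesis by simp
  qed
  have "(\<Prod>c<N ^ n. g (digit N v c)) ^ N = (\<Prod>j<N. \<Prod>c<N ^ n. g ((digit N v c + j) mod N))"
    by (simp flip: shift)
  also have "\<dots> = (\<Prod>c<N ^ n. \<Prod>j<N. g ((digit N v c + j) mod N))" by (rule prod.swap)
  also have "\<dots> = 1" by (simp add: cyc)
  \<comment> \<open>A nonnegative real whose \<open>N\<close>-th power is 1 equals 1.\<close>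
  finally show ?thesis
    using N g(1) by (intro power_eq_imp_eq_base[of _ N 1]) (simp_all add: prod_nonneg)
qed

section \<open>Determinants of the moves\<close>

lemma T_op_unimodular:
  assumes N: "odd N" and br: "dilog_branch N p f" and vw: "v < n" "w < n" "v \<noteq> w"
  shows "unimodular (N ^ n) (T_op N f n v w)"
proof -
  let ?q = "qroot N" and ?d = "N ^ n"
  have N0: "N > 0" using N by (rule odd_pos)
  define X where "X = weyl_product N [P_inv_op N n v, U_op N n v, P_op N n w]"
  define X' where "X' = monomial_mat ?d (shift_digit N n v (N - 1))
    (\<lambda>c. inverse ?q * ?q ^ (2 * digit N v c))"
  define Q where "Q = subtract_op N n w v"
  define A where "A = A_op N n v"
  \<comment> \<open>Negation modulo \<open>N\<close>: the diagonal form found below has inverse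
    powers of \<open>?q\<close>, while \<open>apply_fun\<close> expects exponents
    \<open>2 * k\<close> with \<open>k < N\<close>. The outer \<open>mod\<close> sends 0 to
    0.\<close>
  define e where "e = (\<lambda>k. (N - k) mod N)"
  define L where "L = mat_diag ?d (\<lambda>c. ?q ^ (2 * e (digit N v c)))"
  define E where "E = mat_diag ?d (\<lambda>c. f (?q ^ (2 * e (digit N v c))))"
  have iso: "isometry ?d Q" "isometry ?d A"
    unfolding Q_def A_def using N N0 vw by (simp_all add: subtract_op_isometry A_op_isometry)
  then have c: "Q \<in> carrier_mat ?d ?d" "A \<in> carrier_mat ?d ?d" by (simp_all add: isometry_def)
  define S where "S = Q * A"
  have S: "isometry ?d S" unfolding S_def by (intro isometry_mult iso)
  then have cS: "S \<in> carrier_mat ?d ?d" by (simp add: isometry_def)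
  have X: "X = monomial_mat ?d (\<lambda>c. shift_digit N n v (N - 1) (shift_digit N n w 1 c))
      (\<lambda>c. inverse ?q * ?q ^ (2 * digit N v c))"
    unfolding X_def by (rule weyl_product_monomial[OF N vw])
  then have cX: "X \<in> carrier_mat ?d ?d" by simp
  have cX': "X' \<in> carrier_mat ?d ?d" and cL: "L \<in> carrier_mat ?d ?d" by (simp_all add: X'_def L_def)
  have "?q ^ (2 * e k) = inverse (?q ^ (2 * k))" if "k < N" for k
  proof -
    have "?q ^ (2 * k) * ?q ^ (2 * e k) = ?q ^ (2 * k + 2 * e k)" by (simp only: power_add)
    also have "\<dots> = ?q ^ 0"
    proof (rule qroot_cong[OF N])
      have "(2 * k + 2 * e k) mod N = (2 * k + 2 * (N - k)) mod N"
        unfolding e_def by (intro mod_add_cong refl mod_mult_right_eq)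
      also have "2 * k + 2 * (N - k) = 2 * N" using that by simp
      finally show "(2 * k + 2 * e k) mod N = 0 mod N" by simp
    qed
    finally show ?thesis by (simp add: inverse_unique)
  qed
  then have L': "L = mat_diag ?d (\<lambda>c. inverse (?q ^ (2 * digit N v c)))"
    unfolding L_def using digit_less[OF N0] by simp
  \<comment> \<open>The two intertwining relations in succession: \<open>Q\<close> removes the shift
    of factor \<open>w\<close>, and \<open>A\<close> diagonalizes what remains.\<close>
  have "X * S = (X * Q) * A" unfolding S_def using cX c by (rule assoc_mult_mat[symmetric])
  also have "X * Q = Q * X'"
    unfolding X Q_def X'_def by (rule weyl_subtract_intertwine[OF N0 vw])
  also have "Q * X' * A = Q * (X' * A)" using c(1) cX' c(2) by (rule assoc_mult_mat)
  also have "X' * A = A * L"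
    unfolding X'_def A_def L' by (rule A_op_intertwine[OF N vw(1)])
  also have "Q * (A * L) = S * L" unfolding S_def using c cL by (rule assoc_mult_mat[symmetric])
  finally have "X * S = S * L" .
  then have "apply_fun N f X = S * E * adj S"
    unfolding L_def E_def using S N0
    by (intro apply_fun_diagonalizable[where e = "\<lambda>c. e (digit N v c)"])
      (simp_all add: cX cS isometry_inverse isometry_def e_def)
  then have T: "T_op N f n v w = S * E * adj S * subtract_op N n v w"
    unfolding T_op_def fourier_sum_eq_subtract_op[OF N vw] X_def by simp
  have Q': "isometry ?d (subtract_op N n v w)" using N0 vw by (rule subtract_op_isometry)
  have cE: "E \<in> carrier_mat ?d ?d" by (simp add: E_def)
  \<comment> \<open>Negation permutes the digits, so the product over the eigenvalues is the product
    over all \<open>N\<close>-th roots of unity.\<close>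
  have "inj_on e {..<N}"
    by (rule inj_onI) (auto simp: e_def mod_if split: if_splits)
  moreover have "e ` {..<N} \<subseteq> {..<N}" using N0 by (auto simp: e_def)
  ultimately have "bij_betw e {..<N} {..<N}"
    unfolding bij_betw_def by (intro conjI endo_inj_surj) simp_all
  then have "(\<Prod>k<N. cmod (f (?q ^ (2 * e k)))) = (\<Prod>k<N. cmod (f (?q ^ (2 * k))))"
    by (rule prod.reindex_bij_betw)
  also have "\<dots> = 1" by (rule dilog_branch_norm_prod[OF N br])
  finally have "(\<Prod>c<?d. cmod (f (?q ^ (2 * e (digit N v c))))) = 1"
    by (intro prod_digit_eq_1[OF N0 vw(1)]) simp_all
  then have "unimodular ?d E"
    using cE unfolding unimodular_def E_def det_mat_diag by (simp add: prod_norm)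
  moreover have "unimodular ?d (adj S)"
    using isometry_det[OF S] det_adj[OF cS] cS by (simp add: unimodular_def)
  ultimately show ?thesis
    unfolding T by (intro unimodular_mult isometry_unimodular[OF S] isometry_unimodular[OF Q'])
qed

text \<open>Each move preserves the number of triangles, so all operators of the path act on a space
  of the same dimension and their moduli of determinants multiply.\<close>

lemma move_path_unimodular:
  assumes N: "odd N" and \<Psi>: "dilog_choice N \<Psi>"
    and p: "global_coefficient N S p" "generic_coefficient N S p"
    and path: "move_path S D \<omega> D'"
  shows "unimodular (N ^ length D) (path_op N \<Psi> p (length D) \<omega>)"
  using path
proof (induction rule: move_path.induct)
  case (Nil D D')
  then show ?case by (simp add: path_op_def unimodular_one)
next
  case (Dot D v D1 \<omega> D')
  have len: "length D1 = length D" and v: "v < length D"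
    using Dot.hyps(1) by (auto simp: dot_rotation_def dotted_eq_def)
  have "isometry (N ^ length D) (A_op N (length D) v)" using N v by (rule A_op_isometry)
  with Dot.IH show ?case
    by (simp add: path_op_def len unimodular_mult isometry_unimodular)
next
  case (Flip D v w \<kappa> \<kappa>' D1 \<omega> D')
  let ?n = "length D"
  have len: "length D1 = ?n" and D: "dotted_triangulation S D" and vw: "v < ?n" "w < ?n" "v \<noteq> w"
    and \<kappa>: "\<kappa> \<in> interior_edges S (edges S D)"
    using Flip.hyps(1) by (auto simp: flip_move_def dotted_eq_def Let_def)
  \<comment> \<open>The flipped edge is interior, so its parameter lies on \<open>fermat N\<close>
    and is generic; these are the parameters for which \<open>dilog_choice\<close> provides a
    branch.\<close>
  have "edges S D \<in> ideal_triangulations S" using D by (auto simp: ideal_triangulations_def)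
  moreover have "\<kappa> \<in> edges S D" using \<kappa> by (simp add: interior_edges_def)
  moreover have "\<forall>T\<in>ideal_triangulations S. \<forall>\<alpha>\<in>T.
      p T \<alpha> \<in> (if \<alpha> \<in> interior_edges S T then fermat N else fermat_bar N)"
    using p(1) unfolding global_coefficient_def by (rule conjunct1)
  ultimately have "p (edges S D) \<kappa> \<in> fermat N" "generic N (p (edges S D) \<kappa>)"
    using p(2) \<kappa> unfolding generic_coefficient_def by force+
  then have "dilog_branch N (p (edges S D) \<kappa>) (\<Psi> (p (edges S D) \<kappa>))"
    using \<Psi> by (simp add: dilog_choice_def)
  from T_op_unimodular[OF N this vw] Flip.IH show ?case
    by (simp add: path_op_def len unimodular_mult)
next
  case (Relabel D \<sigma> D1 \<omega> D')
  have len: "length D1 = length D" and \<sigma>: "\<sigma> permutes {..<length D}"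
    using Relabel.hyps(1) by (auto simp: label_permutation_def)
  have "isometry (N ^ length D) (relabel_op N (length D) \<sigma>)"
    using odd_pos[OF N] \<sigma> by (rule relabel_isometry)
  with Relabel.IH show ?case
    by (simp add: path_op_def len unimodular_mult isometry_unimodular)
qed

theorem proposition6p6:
  fixes N :: nat and S :: "'a::t2_space msurface" and \<phi> :: "('a \<Rightarrow> 'a) set"
    and p :: "'a coefficient" and \<Psi> :: "complex \<times> complex \<Rightarrow> complex \<Rightarrow> complex"
    and D :: "'a dotted" and V :: "complex Matrix.mat"
  assumes "odd N"
    and "dilog_choice N \<Psi>"
    and "marked_surface S"
    and "\<phi> \<in> MC S"
    and "global_coefficient N S p"
    and "generic_coefficient N S p"
    and "invariant_coefficient S \<phi> p"
    and "dotted_triangulation S D"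
    and "local_intertwiner N \<Psi> S p \<phi> D V"
  shows "cmod (Determinant.det V) = 1"
proof -
  obtain \<omega> g where path: "move_path S D \<omega> (pullback_dotted S g D)"
    and V: "V = path_op N \<Psi> p (length D) \<omega> * iota_op N (length D)"
    using assms(9) by (auto simp: local_intertwiner_def representation_path_def)
  have "unimodular (N ^ length D) V"
    unfolding V iota_op_def
    by (intro unimodular_mult unimodular_one move_path_unimodular[OF assms(1,2,5,6) path])
  then show ?thesis by (simp add: unimodular_def)
qed

end
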